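(* Let $\mathfrak g$ be a finite-dimensional simple complex Lie algebra with Cartan subalgebra $\mathfrak h$, and let $U_0(\mathfrak g)$ be the centralizer of $\mathfrak h$ in the universal enveloping algebra $U(\mathfrak g)$. With the notation of the context, let $K$ be the ideal of all relations between the generators $J(\mathfrak g)\cup G_0$ of $U_0(\mathfrak g)$, and let $$K'=\{\,c_{i_1}c_{i_2}\cdots c_{i_m}-\mathcal N(c_{i_1}c_{i_2}\cdots c_{i_m})\ :\ m\le d_0,\ c_{i_1},\dots,c_{i_m}\in J(\mathfrak g)\,\}.$$ Then the ideal of relations $K$ is generated by the set $K'$.
   Context: Let $\Delta$ be the root system of $(\mathfrak g,\mathfrak h)$, $\pi$ a basis of $\Delta$, and $G=G_0\cup G_1$ a basis of $\mathfrak g$, where $G_0=\{h_\beta\in\mathfrak h:\beta\in\pi\}$ is a basis of $\mathfrak h$ and $G_1=\{e_\alpha\in\mathfrak g_\alpha\setminus\{0\}:\alpha\in\Delta\}$. Fix a total order on $G$; it induces a total order on $\Delta$ by $\alpha_1\le\alpha_2\iff e_{\alpha_1}\le e_{\alpha_2}$. A list of roots is a finite nonempty multiset of elements of $\Delta$; its weight is the sum of its members (with multiplicity). A zero-weight list is decomposable if it is the disjoint union of two (nonempty) zero-weight lists, and indecomposable otherwise. There are finitely many indecomposable zero-weight lists. A perfect monomial is either an element $h_\beta\in G_0$, or a product $e_{\alpha_1}e_{\alpha_2}\cdots e_{\alpha_n}$ with $\alpha_1\le\alpha_2\le\dots\le\alpha_n$ such that $(\alpha_1,\dots,\alpha_n)$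 is an indecomposable zero-weight list. Let $I(\mathfrak g)=\{p_1,\dots,p_q\}$ be the (finite) set of perfect monomials of degree greater than one, and $d_0$ the maximal degree (number of factors) of a perfect monomial in $I(\mathfrak g)$. Then $I(\mathfrak g)\cup G_0$ generates $U_0(\mathfrak g)$. Let $J(\mathfrak g)=\{c_1,\dots,c_q\}$ be new symbols, and let $Q_0(\mathfrak g)$ be the set of words in the alphabet $J(\mathfrak g)\cup G_0$. For $Y\in Q_0(\mathfrak g)$ let $\omega(Y)$ be the word in the alphabet $G$ obtained by replacing each letter $c_i$ by the word $p_i$ and leaving each $h\in G_0$ unchanged. For a word $X$ in the alphabet $G$, $T_0(X)$ is the set of all words obtained from $X$ by permuting its letters. For $Y\in Q_0(\mathfrak g)$, put $T_1(Y)=\{X\in Q_0(\mathfrak g):T_0(\omega(X))=T_0(\omega(Y))\}$. Fix a total order on $J(\mathfrak g)\cup G_0$ and order each $T_1(Y)$ lexicographically: $x_{i_1}\cdots x_{i_n}<x_{j_1}\cdots x_{j_m}$ if there is $s\le\min(n,m)$ with $x_{i_t}=x_{j_t}$ for $t<s$ and $x_{i_s}<x_{j_s}$. A word $Y$ is semi-perfect if it is the minimal element of $T_1(Y)$. The values in $U_0(\mathfrak g)$ of the semi-perfect words (including the empty word, with value $1$) form a vector space basis of $U_0(\mathfrak g)$. Let $F=\mathbb C[G_0]\langle c_1,\dots,c_q\rangle$ be the free associative algebra on $c_1,\dots,c_q$ over the polynomial ring $\mathbb C[G_0]$ (so the elements of $G_0$ are central in $F$). Let $K$ be the kernel of the surjective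 algebra homomorphism $F\to U_0(\mathfrak g)$ with $c_i\mapsto p_i$ and $h\mapsto h$ for $h\in G_0$; this is the (two-sided) ideal of relations. For $X\in F$, the normal form $\mathcal N(X)\in F$ is the unique linear combination of semi-perfect words having the same image as $X$ in $U_0(\mathfrak g)$. "Generated" means generated as a two-sided ideal of $F$. *)

theory Defs
  imports Complex_Main "HOL-Library.Multiset" "HOL-Library.Poly_Mapping" "HOL-Algebra.QuotRing"
begin

section \<open>Free associative algebras and polynomial rings\<close>

text \<open>
  The monoid of words under concatenation, written additively because the convolution ring
  structure on finitely supported functions in \<^theory>\<open>HOL-Library.Poly_Mapping\<close> is indexed by a
  (not necessarily commutative) additive monoid.
\<close>

datatype 'a word = Word (letters: "'a list")

instantiation word :: (type) monoid_add
begin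

definition zero_word :: "'a word" where "0 = Word []"

definition plus_word :: "'a word \<Rightarrow> 'a word \<Rightarrow> 'a word"
  where "u + v = Word (letters u @ letters v)"

instance by standard (auto simp: zero_word_def plus_word_def)

end

text \<open>
  The free associative algebra on the set \<open>X\<close> over the coefficient ring with underlying set \<open>R\<close>;
  coefficients commute with the generators.
\<close>

definition free_algebra :: "'x set \<Rightarrow> 'r::comm_ring_1 set \<Rightarrow> ('x word \<Rightarrow>\<^sub>0 'r) ring"
  where "free_algebra X R =
    \<lparr>carrier = {f. \<forall>w\<in>Poly_Mapping.keys f. set (letters w) \<subseteq> X \<and> Poly_Mapping.lookup f w \<in> R},
     monoid.mult = (*), one = 1, ring.zero = 0, add = (+)\<rparr>"

definition polynomials :: "'v set \<Rightarrow> (('v \<Rightarrow>\<^sub>0 nat) \<Rightarrow>\<^sub>0 'r::comm_ring_1) set"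
  where "polynomials V = {f. \<forall>m\<in>Poly_Mapping.keys f. Poly_Mapping.keys m \<subseteq> V}"


section \<open>Lie algebras and their enveloping algebras\<close>

locale complex_lie_algebra = vector_space scale
  for scale :: "complex \<Rightarrow> 'g::ab_group_add \<Rightarrow> 'g" +
  fixes bracket :: "'g \<Rightarrow> 'g \<Rightarrow> 'g"
  assumes bracket_add_left: "bracket (x + y) z = bracket x z + bracket y z"
    and bracket_add_right: "bracket x (y + z) = bracket x y + bracket x z"
    and bracket_scale_left: "bracket (scale a x) y = scale a (bracket x y)"
    and bracket_scale_right: "bracket x (scale a y) = scale a (bracket x y)"
    and bracket_self: "bracket x x = 0"
    and jacobi: "bracket x (bracket y z) + bracket y (bracket z x) + bracket z (bracket x y) = 0"
begin

definition finite_dimensional :: bool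
  where "finite_dimensional \<longleftrightarrow> (\<exists>B. finite B \<and> span B = UNIV)"

definition lie_ideal :: "'g set \<Rightarrow> bool"
  where "lie_ideal I \<longleftrightarrow> subspace I \<and> (\<forall>x. \<forall>y\<in>I. bracket x y \<in> I)"

definition simple :: bool
  where "simple \<longleftrightarrow> (\<exists>x y. bracket x y \<noteq> 0) \<and> (\<forall>I. lie_ideal I \<longrightarrow> I = {0} \<or> I = UNIV)"

definition lie_subalgebra :: "'g set \<Rightarrow> bool"
  where "lie_subalgebra S \<longleftrightarrow> subspace S \<and> (\<forall>x\<in>S. \<forall>y\<in>S. bracket x y \<in> S)"

primrec lower_central :: "'g set \<Rightarrow> nat \<Rightarrow> 'g set"
  where "lower_central S 0 = S"
  | "lower_central S (Suc n) = span {bracket x y | x y. x \<in> S \<and> y \<in> lower_central S n}"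

definition normalizer :: "'g set \<Rightarrow> 'g set"
  where "normalizer S = {x. \<forall>y\<in>S. bracket x y \<in> S}"

definition cartan_subalgebra :: "'g set \<Rightarrow> bool"
  where "cartan_subalgebra H \<longleftrightarrow>
    lie_subalgebra H \<and> (\<exists>n. lower_central H n = {0}) \<and> normalizer H = H"

text \<open>Linear forms on \<open>H\<close> are represented by their extensions by \<open>0\<close> outside \<open>H\<close>.\<close>

definition dual :: "'g set \<Rightarrow> ('g \<Rightarrow> complex) set"
  where "dual H = {\<alpha>. (\<forall>s\<in>H. \<forall>t\<in>H. \<alpha> (s + t) = \<alpha> s + \<alpha> t) \<and>
    (\<forall>a. \<forall>t\<in>H. \<alpha> (scale a t) = a * \<alpha> t) \<and> (\<forall>t. t \<notin> H \<longrightarrow> \<alpha> t = 0)}"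

definition root_space :: "'g set \<Rightarrow> ('g \<Rightarrow> complex) \<Rightarrow> 'g set"
  where "root_space H \<alpha> = {x. \<forall>t\<in>H. bracket t x = scale (\<alpha> t) x}"

definition roots :: "'g set \<Rightarrow> ('g \<Rightarrow> complex) set"
  where "roots H = {\<alpha> \<in> dual H. \<alpha> \<noteq> (\<lambda>_. 0) \<and> root_space H \<alpha> \<noteq> {0}}"

definition root_basis :: "'g set \<Rightarrow> ('g \<Rightarrow> complex) set \<Rightarrow> bool"
  where "root_basis H \<pi> \<longleftrightarrow> \<pi> \<subseteq> roots H \<and> finite \<pi> \<and>
    (\<forall>c :: ('g \<Rightarrow> complex) \<Rightarrow> complex.
       (\<forall>t. (\<Sum>\<beta>\<in>\<pi>. c \<beta> * \<beta> t) = 0) \<longrightarrow> (\<forall>\<beta>\<in>\<pi>. c \<beta> = 0)) \<and>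
    (\<forall>\<alpha>\<in>roots H. \<exists>k :: ('g \<Rightarrow> complex) \<Rightarrow> nat.
       (\<forall>t. \<alpha> t = (\<Sum>\<beta>\<in>\<pi>. of_nat (k \<beta>) * \<beta> t)) \<or>
       (\<forall>t. \<alpha> t = - (\<Sum>\<beta>\<in>\<pi>. of_nat (k \<beta>) * \<beta> t)))"

text \<open>
  \<open>U(\<gg>)\<close> is the free algebra on the set \<open>\<gg>\<close> modulo the linear relations, which make it the tensor
  algebra of \<open>\<gg>\<close>, and the relations \<open>x y - y x = [x, y]\<close>.
\<close>

abbreviation word_algebra :: "('g word \<Rightarrow>\<^sub>0 complex) ring"
  where "word_algebra \<equiv> free_algebra UNIV UNIV"

definition letter :: "'g \<Rightarrow> 'g word \<Rightarrow>\<^sub>0 complex"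
  where "letter x = Poly_Mapping.single (Word [x]) 1"

definition enveloping_relations :: "('g word \<Rightarrow>\<^sub>0 complex) set"
  where "enveloping_relations =
    {letter (x + y) - (letter x + letter y) | x y. True} \<union>
    {letter (scale a x) - Poly_Mapping.single 0 a * letter x | a x. True} \<union>
    {letter x * letter y - letter y * letter x - letter (bracket x y) | x y. True}"

definition enveloping_algebra :: "('g word \<Rightarrow>\<^sub>0 complex) set ring"
  where "enveloping_algebra = word_algebra Quot (Idl\<^bsub>word_algebra\<^esub> enveloping_relations)"

definition env_class :: "('g word \<Rightarrow>\<^sub>0 complex) \<Rightarrow> ('g word \<Rightarrow>\<^sub>0 complex) set"
  where "env_class f = (Idl\<^bsub>word_algebra\<^esub> enveloping_relations) +>\<^bsub>word_algebra\<^esub> f"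

definition env_scalar :: "complex \<Rightarrow> ('g word \<Rightarrow>\<^sub>0 complex) set"
  where "env_scalar a = env_class (Poly_Mapping.single 0 a)"

definition env_word :: "'g list \<Rightarrow> ('g word \<Rightarrow>\<^sub>0 complex) set"
  where "env_word X = env_class (Poly_Mapping.single (Word X) 1)"

definition env_centralizer :: "'g set \<Rightarrow> ('g word \<Rightarrow>\<^sub>0 complex) set ring"
  where "env_centralizer H = enveloping_algebra
    \<lparr>carrier := {u \<in> carrier enveloping_algebra. \<forall>t\<in>H.
       env_word [t] \<otimes>\<^bsub>enveloping_algebra\<^esub> u = u \<otimes>\<^bsub>enveloping_algebra\<^esub> env_word [t]}\<rparr>"

end


section \<open>Perfect monomials and semi-perfect words\<close>

text \<open>The symbol \<open>c\<^sub>i\<close> attached to the perfect monomial \<open>p\<^sub>i\<close> is \<open>Csym p\<^sub>i\<close>.\<close>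

datatype 'g gen = Csym "'g list" | Hsym 'g

definition T0 :: "'a list \<Rightarrow> 'a list set"
  where "T0 X = {Z. mset Z = mset X}"

primrec gen_word :: "'g gen \<Rightarrow> 'g list"
  where "gen_word (Csym p) = p"
  | "gen_word (Hsym h) = [h]"

definition omega :: "'g gen list \<Rightarrow> 'g list"
  where "omega Y = concat (map gen_word Y)"

text \<open>The strict part of the lexicographic order induced by the reflexive order \<open>r\<close>.\<close>

definition lex_less :: "('a \<times> 'a) set \<Rightarrow> 'a list \<Rightarrow> 'a list \<Rightarrow> bool"
  where "lex_less r X Y \<longleftrightarrow> (\<exists>s < min (length X) (length Y).
    (\<forall>t<s. X ! t = Y ! t) \<and> X ! s \<noteq> Y ! s \<and> (X ! s, Y ! s) \<in> r)"

locale ordered_root_basis = complex_lie_algebra scale bracket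
  for scale :: "complex \<Rightarrow> 'g::ab_group_add \<Rightarrow> 'g" and bracket :: "'g \<Rightarrow> 'g \<Rightarrow> 'g" +
  fixes H :: "'g set"
    and \<pi> :: "('g \<Rightarrow> complex) set"
    and h :: "('g \<Rightarrow> complex) \<Rightarrow> 'g"
    and e :: "('g \<Rightarrow> complex) \<Rightarrow> 'g"
    and ordG :: "('g \<times> 'g) set"
  assumes root_basis: "root_basis H \<pi>"
    and h_inj: "inj_on h \<pi>"
    and h_indep: "independent (h ` \<pi>)"
    and h_span: "span (h ` \<pi>) = H"
    and e_root: "\<alpha> \<in> roots H \<Longrightarrow> e \<alpha> \<in> root_space H \<alpha> - {0}"
    and G_indep: "independent (h ` \<pi> \<union> e ` roots H)"
    and G_span: "span (h ` \<pi> \<union> e ` roots H) = UNIV"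
    and ordG: "linear_order_on (h ` \<pi> \<union> e ` roots H) ordG"
begin

definition G0 :: "'g set"
  where "G0 = h ` \<pi>"

definition zero_weight :: "('g \<Rightarrow> complex) multiset \<Rightarrow> bool"
  where "zero_weight L \<longleftrightarrow> L \<noteq> {#} \<and> set_mset L \<subseteq> roots H \<and> (\<forall>t\<in>H. (\<Sum>\<alpha>\<in>#L. \<alpha> t) = 0)"

definition indecomposable :: "('g \<Rightarrow> complex) multiset \<Rightarrow> bool"
  where "indecomposable L \<longleftrightarrow> zero_weight L \<and>
    \<not> (\<exists>L1 L2. L = L1 + L2 \<and> zero_weight L1 \<and> zero_weight L2)"

definition perfect_monomials :: "'g list set"
  where "perfect_monomials = {[b] | b. b \<in> G0} \<union>
    {map e as | as. sorted_wrt (\<lambda>\<alpha> \<beta>. (e \<alpha>, e \<beta>) \<in> ordG) as \<and> indecomposable (mset as)}"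

definition I :: "'g list set"
  where "I = {p \<in> perfect_monomials. length p > 1}"

definition d0 :: nat
  where "d0 = Max (length ` I)"

definition J :: "'g gen set"
  where "J = Csym ` I"

definition alphabet :: "'g gen set"
  where "alphabet = J \<union> Hsym ` G0"

definition Q0 :: "'g gen list set"
  where "Q0 = lists alphabet"

definition T1 :: "'g gen list \<Rightarrow> 'g gen list set"
  where "T1 Y = {X \<in> Q0. T0 (omega X) = T0 (omega Y)}"

text \<open>
  \<open>F = \<complex>[G\<^sub>0]\<langle>c\<^sub>1, \<dots>, c\<^sub>q\<rangle>\<close>. A coefficient is an element of \<open>\<complex>[G\<^sub>0]\<close>, that is, a finitely
  supported function on monomials with variables in \<open>G\<^sub>0\<close>.
\<close>

definition F :: "('g gen word \<Rightarrow>\<^sub>0 (('g \<Rightarrow>\<^sub>0 nat) \<Rightarrow>\<^sub>0 complex)) ring"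
  where "F = free_algebra J (polynomials G0)"

definition F_scalar :: "complex \<Rightarrow> 'g gen word \<Rightarrow>\<^sub>0 (('g \<Rightarrow>\<^sub>0 nat) \<Rightarrow>\<^sub>0 complex)"
  where "F_scalar a = Poly_Mapping.single 0 (Poly_Mapping.single 0 a)"

primrec F_gen :: "'g gen \<Rightarrow> 'g gen word \<Rightarrow>\<^sub>0 (('g \<Rightarrow>\<^sub>0 nat) \<Rightarrow>\<^sub>0 complex)"
  where "F_gen (Csym p) = Poly_Mapping.single (Word [Csym p]) 1"
  | "F_gen (Hsym t) = Poly_Mapping.single 0 (Poly_Mapping.single (Poly_Mapping.single t 1) 1)"

definition F_word :: "'g gen list \<Rightarrow> 'g gen word \<Rightarrow>\<^sub>0 (('g \<Rightarrow>\<^sub>0 nat) \<Rightarrow>\<^sub>0 complex)"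
  where "F_word Y = prod_list (map F_gen Y)"

text \<open>
  The algebra homomorphism \<open>F \<rightarrow> U\<^sub>0(\<gg>)\<close> with \<open>c\<^sub>i \<mapsto> p\<^sub>i\<close> and \<open>h \<mapsto> h\<close>. Since HOL functions are
  total, it is made unique by fixing its (irrelevant) value outside the carrier of \<open>F\<close>.
\<close>

definition eval_hom ::
    "('g gen word \<Rightarrow>\<^sub>0 (('g \<Rightarrow>\<^sub>0 nat) \<Rightarrow>\<^sub>0 complex)) \<Rightarrow> ('g word \<Rightarrow>\<^sub>0 complex) set"
  where "eval_hom = (THE \<phi>. \<phi> \<in> extensional (carrier F) \<and> \<phi> \<in> ring_hom F (env_centralizer H) \<and>
    (\<forall>a. \<phi> (F_scalar a) = env_scalar a) \<and> (\<forall>x\<in>alphabet. \<phi> (F_gen x) = env_word (gen_word x)))"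

definition K :: "('g gen word \<Rightarrow>\<^sub>0 (('g \<Rightarrow>\<^sub>0 nat) \<Rightarrow>\<^sub>0 complex)) set"
  where "K = a_kernel F (env_centralizer H) eval_hom"

end

locale ordered_generators = ordered_root_basis scale bracket H \<pi> h e ordG
  for scale :: "complex \<Rightarrow> 'g::ab_group_add \<Rightarrow> 'g"
    and bracket :: "'g \<Rightarrow> 'g \<Rightarrow> 'g"
    and H :: "'g set"
    and \<pi> :: "('g \<Rightarrow> complex) set"
    and h :: "('g \<Rightarrow> complex) \<Rightarrow> 'g"
    and e :: "('g \<Rightarrow> complex) \<Rightarrow> 'g"
    and ordG :: "('g \<times> 'g) set" +
  fixes ordA :: "('g gen \<times> 'g gen) set"
  assumes ordA: "linear_order_on alphabet ordA"
begin

definition semi_perfect :: "'g gen list \<Rightarrow> bool"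
  where "semi_perfect Y \<longleftrightarrow> Y \<in> Q0 \<and> (\<forall>X\<in>T1 Y. X \<noteq> Y \<longrightarrow> lex_less ordA Y X)"

definition semi_perfect_span :: "('g gen word \<Rightarrow>\<^sub>0 (('g \<Rightarrow>\<^sub>0 nat) \<Rightarrow>\<^sub>0 complex)) set"
  where "semi_perfect_span = module.span (\<lambda>a f. F_scalar a * f) (F_word ` {Y. semi_perfect Y})"

definition normal_form :: "('g gen word \<Rightarrow>\<^sub>0 (('g \<Rightarrow>\<^sub>0 nat) \<Rightarrow>\<^sub>0 complex)) \<Rightarrow>
    ('g gen word \<Rightarrow>\<^sub>0 (('g \<Rightarrow>\<^sub>0 nat) \<Rightarrow>\<^sub>0 complex))"
  where "normal_form X = (THE N. N \<in> semi_perfect_span \<and> eval_hom N = eval_hom X)"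

definition K' :: "('g gen word \<Rightarrow>\<^sub>0 (('g \<Rightarrow>\<^sub>0 nat) \<Rightarrow>\<^sub>0 complex)) set"
  where "K' = {F_word cs - normal_form (F_word cs) | cs. cs \<in> lists J \<and> length cs \<le> d0}"

end

end

theory Submission
  imports Defs
begin

text \<open>
  The relations in \<open>K'\<close> hold in \<open>U\<^sub>0(\<gg>)\<close>, so the ideal they generate lies in \<open>K\<close>. The converse follows from two
  facts: modulo this ideal every element of \<open>F\<close> is congruent to a combination of semi-perfect words
  (\<open>carrier_F_reduces\<close>), and a nonzero combination of semi-perfect words does not vanish in \<open>U(\<gg>)\<close>
  (\<open>semi_perfect_span_independent\<close>).

  Reduction. Let the degree of a word \<open>Y\<close> in the generators be the length of \<open>omega Y\<close>. Up to words of
  smaller degree, the value of \<open>Y\<close> in \<open>U\<^sub>0(\<gg>)\<close> depends only on the multiset of letters of \<open>omega Y\<close>, and the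
  semi-perfect word with a given multiset \<open>M\<close> is found greedily: it begins with the least letter \<open>c\<close> whose
  monomial \<open>p\<^sub>c\<close> is contained in \<open>M\<close>. If \<open>X\<close> is any word with this multiset, then at most
  \<open>length p\<^sub>c \<le> d\<^sub>0\<close> letters of \<open>X\<close> suffice to cover \<open>p\<^sub>c\<close>; if \<open>c\<close> is an element
  of \<open>G\<^sub>0\<close>, the central letter \<open>c\<close> alone does. Commuting them to the front uses only relations with
  two factors, and the product \<open>S\<close> of these letters may be replaced by its normal form. The leading word
  of that normal form begins with \<open>c\<close> too, because \<open>c\<close> divides \<open>omega S\<close> and no smaller letter does. So \<open>X\<close>
  becomes \<open>c\<close> times a word of smaller degree, up to terms of smaller degree, and induction applies
  (\<open>word_reduces\<close>).

  Independence. Instead of a basis of \<open>U(\<gg>)\<close>, enough linear functionals on it are constructed. Products of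
  functionals are defined by the comultiplication (\<open>shuffle\<close>). As \<open>\<gg>\<close> has trivial centre, matrix coefficients
  of the adjoint representation provide functionals that vanish at \<open>1\<close> and restrict to the coordinate
  functions on \<open>\<gg>\<close> (\<open>coordinate_lie_functional\<close>). The product of \<open>k\<close> of them vanishes on words with fewer than
  \<open>k\<close> letters, and on a word of \<open>k\<close> basis vectors it counts the bijections matching the letters with the
  factors. Hence words with different multisets of letters are independent (\<open>monomials_independent\<close>).

  That normal forms exist at all, with the semi-perfect word of the class as leading term, is seen by
  sorting words: the bracket of two weight vectors has the sum of their weights, so exchanging
  neighbours in a word of weight zero produces shorter words of weight zero (\<open>monomial_normal_form\<close>). The
  evaluation of \<open>F\<close> is well defined because \<open>\<hh>\<close> is abelian (\<open>H_abelian\<close>) and commutes with words of weight zero.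
\<close>

section \<open>Finiteness, orders and permutations\<close>

text \<open>
  A sequence of natural numbers has a nondecreasing subsequence, because every tail attains its
  minimum; the coordinates in \<open>A\<close> are treated one after the other.
\<close>

lemma nat_valued_monotone_subsequence:
  fixes f :: "nat \<Rightarrow> 'a \<Rightarrow> nat"
  assumes "finite A"
  shows "\<exists>r :: nat \<Rightarrow> nat. strict_mono r \<and> (\<forall>a\<in>A. \<forall>i j. i \<le> j \<longrightarrow> f (r i) a \<le> f (r j) a)"
  using assms
proof (induction A rule: finite_induct)
  case empty
  show ?case by (rule exI[of _ "\<lambda>n. n"]) (simp add: strict_mono_def)
next
  case (insert a A)
  then obtain r :: "nat \<Rightarrow> nat" where r1: "strict_mono r"
    and r2: "\<forall>a\<in>A. \<forall>i j. i \<le> j \<longrightarrow> f (r i) a \<le> f (r j) a"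
    by (elim exE conjE)
  define g where "g = (\<lambda>n. f (r n) a)"
  have "\<exists>b\<ge>m. \<forall>n\<ge>m. g b \<le> g n" for m
    using ex_has_least_nat[of "\<lambda>n. m \<le> n" m g] by blast
  then obtain best where best: "\<And>m. best m \<ge> m" "\<And>m n. n \<ge> m \<Longrightarrow> g (best m) \<le> g n"
    by metis
  \<comment> \<open>Choose minimal positions of the new coordinate one after the other.\<close>
  define s where "s = rec_nat (best 0) (\<lambda>_ m. best (Suc m))"
  have s0: "s 0 = best 0" and sS: "s (Suc n) = best (Suc (s n))" for n
    by (simp_all add: s_def)
  have less: "s n < s (Suc n)" for n
    using best(1)[of "Suc (s n)"] by (simp add: sS)
  then have mono: "strict_mono s"
    by (simp add: strict_mono_Suc_iff)
  have "g (s n) \<le> g (s (Suc n))" for n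
  proof (cases n)
    case 0
    show ?thesis unfolding 0 s0 by (rule best(2)) simp
  next
    case (Suc k)
    have "Suc (s k) \<le> s (Suc n)"
      using less[of k] less[of n] Suc by simp
    then show ?thesis using best(2)[of "Suc (s k)" "s (Suc n)"] Suc sS[of k] by simp
  qed
  then have "g (s i) \<le> g (s j)" if "i \<le> j" for i j
    using that by (rule lift_Suc_mono_le)
  moreover have "f (r (s i)) b \<le> f (r (s j)) b" if "b \<in> A" "i \<le> j" for b i j
    using r2[rule_format, OF that(1), of "s i" "s j"] monoD[OF strict_mono_mono[OF mono] that(2)] by blast
  ultimately have "\<forall>b\<in>insert a A. \<forall>i j. i \<le> j \<longrightarrow> f ((r \<circ> s) i) b \<le> f ((r \<circ> s) j) b"
    by (simp add: g_def)
  then show ?case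
    using strict_mono_o[OF r1 mono] by blast
qed

text \<open>
  Dickson's lemma. In a sequence of distinct members of an infinite antichain one could pass to a
  subsequence along which all multiplicities are nondecreasing, and its first two terms would be
  comparable.
\<close>

lemma finite_antichain_multisets:
  assumes "finite A" and sub: "\<And>M. M \<in> S \<Longrightarrow> set_mset M \<subseteq> A"
    and anti: "\<And>M N. M \<in> S \<Longrightarrow> N \<in> S \<Longrightarrow> M \<subseteq># N \<Longrightarrow> M = N"
  shows "finite S"
proof (rule ccontr)
  assume "infinite S"
  then obtain f :: "nat \<Rightarrow> 'a multiset" where f: "inj f" "range f \<subseteq> S"
    using infinite_countable_subset by blast
  obtain r :: "nat \<Rightarrow> nat" where r1: "strict_mono r"
    and r2: "\<forall>a\<in>A. \<forall>i j. i \<le> j \<longrightarrow> count (f (r i)) a \<le> count (f (r j)) a"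
    using nat_valued_monotone_subsequence[OF \<open>finite A\<close>, of "\<lambda>n. count (f n)"]
    by (elim exE conjE)
  have "count (f (r 0)) a \<le> count (f (r 1)) a" for a
  proof (cases "a \<in> A")
    case False
    then have "a \<notin># f (r 0)" using sub f(2) by (meson rangeI subset_iff)
    then have "count (f (r 0)) a = 0" by (simp add: count_eq_zero_iff)
    then show ?thesis by simp
  qed (simp add: r2)
  then have "f (r 0) \<subseteq># f (r 1)"
    by (simp add: subseteq_mset_def)
  then have "f (r 0) = f (r 1)" using anti f(2) by blast
  then have "r 0 = r 1" using f(1) by (simp add: inj_eq)
  then show False using strict_monoD[OF r1, of 0 1] by simp
qed

text \<open>
  Adjacent transpositions generate all permutations. Here \<open>D\<close> is the set of errors that may be
  neglected. Swaps are considered only between arrangements of one fixed multiset \<open>M\<close>, because the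
  errors admitted later depend on the length of the word.
\<close>

lemma adjacent_swaps_imp_permutation:
  fixes f :: "'a list \<Rightarrow> 'b::ab_group_add"
  assumes swap: "\<And>A x y B. mset (A @ [x, y] @ B) = M \<Longrightarrow> f (A @ [x, y] @ B) - f (A @ [y, x] @ B) \<in> D"
    and zero: "0 \<in> D" and add: "\<And>a b. a \<in> D \<Longrightarrow> b \<in> D \<Longrightarrow> a + b \<in> D"
    and minus: "\<And>a. a \<in> D \<Longrightarrow> - a \<in> D"
    and "mset X = M" "mset Y = M"
  shows "f X - f Y \<in> D"
proof -
  have trans: "f U - f W \<in> D" if "f U - f V \<in> D" "f V - f W \<in> D" for U V W
    using add[OF that] by simp
  have front: "f (P @ x # A @ B) - f (P @ A @ x # B) \<in> D" if "mset (P @ A @ x # B) = M" for P A x B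
    using that
  proof (induction A arbitrary: B rule: rev_induct)
    case (snoc a A)
    have "f (P @ x # A @ a # B) - f (P @ A @ x # a # B) \<in> D"
      using snoc.prems by (intro snoc.IH) (simp add: add_mset_commute)
    moreover have "f ((P @ A) @ [x, a] @ B) - f ((P @ A) @ [a, x] @ B) \<in> D"
      using snoc.prems by (intro swap) (simp add: add_mset_commute)
    ultimately show ?case using trans[of _ "P @ A @ x # a # B"] by simp
  qed (simp add: zero)
  have "f (P @ X) - f (P @ Y) \<in> D" if "mset (P @ X) = M" "mset X = mset Y" for P X Y
    using that
  proof (induction X arbitrary: P Y)
    case (Cons x X)
    then have "x \<in> set Y" by (metis list.set_intros(1) mset_eq_setD)
    then obtain A B where Y: "Y = A @ x # B" by (meson split_list)
    have "f ((P @ [x]) @ X) - f ((P @ [x]) @ (A @ B)) \<in> D"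
      using Cons.prems by (intro Cons.IH) (auto simp: Y)
    moreover have "f (P @ x # A @ B) - f (P @ A @ x # B) \<in> D"
      using Cons.prems by (intro front) (auto simp: Y)
    ultimately show ?case using trans[of "P @ x # X" "P @ x # A @ B"] by (simp add: Y)
  qed (simp add: zero)
  from this[of "[]"] show ?thesis using assms(5,6) by simp
qed

lemma linear_order_on_rules:
  assumes "linear_order_on A r"
  shows "x \<in> A \<Longrightarrow> (x, x) \<in> r"
    and "(x, y) \<in> r \<Longrightarrow> (y, z) \<in> r \<Longrightarrow> (x, z) \<in> r"
    and "(x, y) \<in> r \<Longrightarrow> (y, x) \<in> r \<Longrightarrow> x = y"
    and "x \<in> A \<Longrightarrow> y \<in> A \<Longrightarrow> (x, y) \<in> r \<or> (y, x) \<in> r"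
proof -
  have "refl_on A r" "trans r" "antisym r" "total_on A r"
    using assms by (auto simp: order_on_defs)
  then show "x \<in> A \<Longrightarrow> (x, x) \<in> r"
    and "(x, y) \<in> r \<Longrightarrow> (y, z) \<in> r \<Longrightarrow> (x, z) \<in> r"
    and "(x, y) \<in> r \<Longrightarrow> (y, x) \<in> r \<Longrightarrow> x = y"
    and "x \<in> A \<Longrightarrow> y \<in> A \<Longrightarrow> (x, y) \<in> r \<or> (y, x) \<in> r"
    by (blast dest: refl_onD, blast dest: transD, blast dest: antisymD,
        cases "x = y", blast dest: refl_onD, simp add: total_on_def)
qed

lemma exists_sorted_list:
  assumes r: "linear_order_on A r" and "set_mset M \<subseteq> A"
  shows "\<exists>xs. mset xs = M \<and> sorted_wrt (\<lambda>x y. (x, y) \<in> r) xs"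
proof -
  note trans = linear_order_on_rules(2)[OF r] and tot = linear_order_on_rules(4)[OF r]
  have ins: "\<exists>ys. mset ys = add_mset a (mset xs) \<and> sorted_wrt (\<lambda>x y. (x, y) \<in> r) ys"
    if "a \<in> A" "set xs \<subseteq> A" "sorted_wrt (\<lambda>x y. (x, y) \<in> r) xs" for a xs
    using that
  proof (induction xs)
    case (Cons x xs)
    show ?case
    proof (cases "(a, x) \<in> r")
      case True
      then show ?thesis using Cons.prems trans[of a x] by (intro exI[of _ "a # x # xs"]) auto
    next
      case False
      then have xa: "(x, a) \<in> r" using tot[of a x] Cons.prems by auto
      obtain ys where ys: "mset ys = add_mset a (mset xs)" "sorted_wrt (\<lambda>x y. (x, y) \<in> r) ys"
        using Cons by auto
      have "set ys = insert a (set xs)" using arg_cong[OF ys(1), of set_mset] by simp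
      then show ?thesis using ys xa Cons.prems by (intro exI[of _ "x # ys"]) auto
    qed
  qed (rule exI[of _ "[a]"], simp)
  show ?thesis using assms(2)
  proof (induction M)
    case (add a M)
    then obtain xs where xs: "mset xs = M" "sorted_wrt (\<lambda>x y. (x, y) \<in> r) xs" by auto
    then have "set xs \<subseteq> A" using add.prems by auto
    then show ?case using ins[of a xs] xs add.prems by auto
  qed simp
qed

lemma exists_least:
  assumes r: "linear_order_on A r" and "finite B" "B \<noteq> {}" "B \<subseteq> A"
  shows "\<exists>c\<in>B. \<forall>b\<in>B. (c, b) \<in> r"
  using assms(2,3,4)
proof (induction B rule: finite_ne_induct)
  case (singleton x)
  then show ?case using linear_order_on_rules(1)[OF r] by auto
next
  case (insert x B)
  then obtain c where c: "c \<in> B" "\<And>b. b \<in> B \<Longrightarrow> (c, b) \<in> r" by auto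
  have xx: "(x, x) \<in> r" using linear_order_on_rules(1)[OF r] insert.prems by blast
  consider "(c, x) \<in> r" | "(x, c) \<in> r"
    using linear_order_on_rules(4)[OF r, of c x] insert.prems c(1) by blast
  then show ?case
  proof cases
    case 1
    then show ?thesis using c by blast
  next
    case 2
    have "(x, b) \<in> r" if "b \<in> B" for b
      using linear_order_on_rules(2)[OF r 2 c(2)[OF that]] .
    then show ?thesis using xx by blast
  qed
qed

text \<open>
  By induction on the number of functionals: adding one either leaves the common kernel unchanged
  or shrinks it by one dimension, and in the second case a vector on which only the new functional
  is nonzero determines its coefficient.
\<close>

lemma (in vector_space) functional_in_span:
  fixes \<phi> :: "'i \<Rightarrow> 'b \<Rightarrow> 'a"
  assumes "finite J" and "\<And>i. i \<in> J \<Longrightarrow> Vector_Spaces.linear scale (*) (\<phi> i)" and "Vector_Spaces.linear scale (*) \<psi>"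
    and "\<And>x. (\<And>i. i \<in> J \<Longrightarrow> \<phi> i x = 0) \<Longrightarrow> \<psi> x = 0"
  shows "\<exists>c. \<forall>x. \<psi> x = (\<Sum>i\<in>J. c i * \<phi> i x)"
  using assms
proof (induction J arbitrary: \<psi> rule: finite_induct)
  case (insert j J)
  interpret \<psi>: Vector_Spaces.linear scale "(*)" \<psi> by fact
  interpret j: Vector_Spaces.linear scale "(*)" "\<phi> j" using insert.prems by simp
  show ?case
  proof (cases "\<forall>x. (\<forall>i\<in>J. \<phi> i x = 0) \<longrightarrow> \<phi> j x = 0")
    case True
    have "\<exists>c. \<forall>x. \<psi> x = (\<Sum>i\<in>J. c i * \<phi> i x)"
    proof (rule insert.IH)
      fix x assume "\<And>i. i \<in> J \<Longrightarrow> \<phi> i x = 0"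
      then have "\<And>i. i \<in> insert j J \<Longrightarrow> \<phi> i x = 0" using True by blast
      then show "\<psi> x = 0" by (rule insert.prems(3))
    qed (use insert.prems(1,2) in blast)+
    then obtain c where c: "\<And>x. \<psi> x = (\<Sum>i\<in>J. c i * \<phi> i x)" by auto
    have "\<psi> x = (\<Sum>i\<in>insert j J. (c(j := 0)) i * \<phi> i x)" for x
      using insert.hyps by (auto simp: c intro!: sum.cong)
    then show ?thesis by blast
  next
    case False
    then obtain y where y: "\<And>i. i \<in> J \<Longrightarrow> \<phi> i y = 0" "\<phi> j y \<noteq> 0" by auto
    define d where "d = \<psi> y / \<phi> j y"
    have lin': "Vector_Spaces.linear scale (*) (\<lambda>x. \<psi> x - d * \<phi> j x)"
    proof (unfold_locales, goal_cases)
      case (1 x y)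
      show ?case by (simp only: \<psi>.add j.add distrib_left add_diff_add)
    next
      case (2 r x)
      show ?case by (simp only: \<psi>.scale j.scale right_diff_distrib mult.left_commute)
    qed
    have "\<exists>c. \<forall>x. \<psi> x - d * \<phi> j x = (\<Sum>i\<in>J. c i * \<phi> i x)"
    proof (rule insert.IH)
      fix x assume x: "\<And>i. i \<in> J \<Longrightarrow> \<phi> i x = 0"
      \<comment> \<open>Correct \<open>x\<close> by a multiple of \<open>y\<close> so that the new functional vanishes too.\<close>
      define z where "z = x - scale (\<phi> j x / \<phi> j y) y"
      have "\<phi> i z = 0" if "i \<in> insert j J" for i
      proof -
        interpret i: Vector_Spaces.linear scale "(*)" "\<phi> i" using insert.prems(1)[OF that] .
        show ?thesis using that x y by (auto simp: z_def i.diff i.scale)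
      qed
      then have "\<psi> z = 0" by (rule insert.prems(3))
      then show "\<psi> x - d * \<phi> j x = 0"
        by (simp add: z_def \<psi>.diff \<psi>.scale d_def)
    qed (use insert.prems(1) lin' in blast)+
    then obtain c where c: "\<And>x. \<psi> x - d * \<phi> j x = (\<Sum>i\<in>J. c i * \<phi> i x)" by auto
    have "\<psi> x = (\<Sum>i\<in>insert j J. (c(j := d)) i * \<phi> i x)" for x
    proof -
      have "(\<Sum>i\<in>J. (c(j := d)) i * \<phi> i x) = (\<Sum>i\<in>J. c i * \<phi> i x)"
        using insert.hyps by (auto intro!: sum.cong)
      then show ?thesis using insert.hyps c[of x] by (simp add: algebra_simps)
    qed
    then show ?thesis by blast
  qed
qed simp

section \<open>Finitely supported functions and free algebras\<close>

lemma poly_mapping_sum_singles: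
  "f = (\<Sum>k\<in>Poly_Mapping.keys f. Poly_Mapping.single k (Poly_Mapping.lookup f k))"
proof (rule poly_mapping_eqI)
  fix k
  show "Poly_Mapping.lookup f k =
      Poly_Mapping.lookup (\<Sum>k\<in>Poly_Mapping.keys f. Poly_Mapping.single k (Poly_Mapping.lookup f k)) k"
    by (simp add: lookup_sum lookup_single when_def sum.delta in_keys_iff)
qed

lemma poly_mapping_singles_induct [case_names zero single add]:
  fixes f :: "'a \<Rightarrow>\<^sub>0 'b::comm_monoid_add"
  assumes "P 0" and "\<And>k. k \<in> Poly_Mapping.keys f \<Longrightarrow> P (Poly_Mapping.single k (Poly_Mapping.lookup f k))"
    and add: "\<And>f g. P f \<Longrightarrow> P g \<Longrightarrow> P (f + g)"
  shows "P f"
proof -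
  have "P (\<Sum>k\<in>B. Poly_Mapping.single k (Poly_Mapping.lookup f k))"
    if "finite B" "B \<subseteq> Poly_Mapping.keys f" for B
    using that by (induction B rule: finite_induct) (auto intro: assms)
  from this[of "Poly_Mapping.keys f"] show ?thesis
    using poly_mapping_sum_singles[of f] by simp
qed

text \<open>
  Both the linear extension of a functional on words and the evaluation of \<open>F\<close> are of this shape; in
  the second case the coefficients are polynomials, which are extended by the same construction.
\<close>

definition additive_extension :: "('k \<Rightarrow> 'v::comm_monoid_add \<Rightarrow> 'b::comm_monoid_add) \<Rightarrow> ('k \<Rightarrow>\<^sub>0 'v) \<Rightarrow> 'b"
  where "additive_extension g f = (\<Sum>k\<in>Poly_Mapping.keys f. g k (Poly_Mapping.lookup f k))"

lemma additive_extension_zero [simp]: "additive_extension g 0 = 0"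
  by (simp add: additive_extension_def)

lemma additive_extension_single:
  assumes "g k 0 = 0"
  shows "additive_extension g (Poly_Mapping.single k v) = g k v"
  using assms by (simp add: additive_extension_def)

lemma additive_extension_add:
  assumes "\<And>k. g k 0 = 0" and "\<And>k a b. g k (a + b) = g k a + g k b"
  shows "additive_extension g (p + q) = additive_extension g p + additive_extension g q"
  unfolding additive_extension_def using assms by (rule setsum_keys_plus_distrib)

lemma lookup_mult_closed:
  fixes f g :: "'k::monoid_add \<Rightarrow>\<^sub>0 'r::ring_1"
  assumes "0 \<in> R" and add: "\<And>a b. a \<in> R \<Longrightarrow> b \<in> R \<Longrightarrow> a + b \<in> R"
    and mult: "\<And>a b. a \<in> R \<Longrightarrow> b \<in> R \<Longrightarrow> a * b \<in> R"
    and f: "\<And>k. Poly_Mapping.lookup f k \<in> R" and g: "\<And>k. Poly_Mapping.lookup g k \<in> R"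
  shows "Poly_Mapping.lookup (f * g) k \<in> R"
proof -
  have *: "\<forall>k. Poly_Mapping.lookup (Poly_Mapping.single l v * g) k \<in> R" if "v \<in> R" for l v
    by (induction g rule: poly_mapping_singles_induct)
      (auto simp: mult_single lookup_single when_def distrib_left lookup_add assms(1) intro: add mult that g)
  have "\<forall>k. Poly_Mapping.lookup (f * g) k \<in> R"
    by (induction f rule: poly_mapping_singles_induct)
      (auto simp: distrib_right lookup_add assms(1) intro: add *[rule_format] f)
  then show ?thesis ..
qed

lemma free_algebra_simps:
  "monoid.mult (free_algebra X R) = (*)" "one (free_algebra X R) = 1"
  "ring.zero (free_algebra X R) = 0" "add (free_algebra X R) = (+)"
  by (simp_all add: free_algebra_def)

lemma mem_free_algebra:
  assumes "0 \<in> R"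
  shows "f \<in> carrier (free_algebra X R) \<longleftrightarrow>
    (\<forall>w\<in>Poly_Mapping.keys f. set (letters w) \<subseteq> X) \<and> (\<forall>w. Poly_Mapping.lookup f w \<in> R)"
  unfolding free_algebra_def using assms by (auto simp: in_keys_iff)

lemma free_algebra_closed:
  fixes X :: "'x set" and R :: "'r::comm_ring_1 set"
  assumes R: "0 \<in> R" "1 \<in> R" "\<And>a b. a \<in> R \<Longrightarrow> b \<in> R \<Longrightarrow> a + b \<in> R"
    "\<And>a b. a \<in> R \<Longrightarrow> b \<in> R \<Longrightarrow> a * b \<in> R" "\<And>a. a \<in> R \<Longrightarrow> - a \<in> R"
  defines "C \<equiv> carrier (free_algebra X R)"
  shows "0 \<in> C" "1 \<in> C" "f \<in> C \<Longrightarrow> g \<in> C \<Longrightarrow> f + g \<in> C" "f \<in> C \<Longrightarrow> g \<in> C \<Longrightarrow> f * g \<in> C"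
    "f \<in> C \<Longrightarrow> - f \<in> C"
proof -
  note C = mem_free_algebra[OF R(1), of _ X, folded C_def]
  show "0 \<in> C" "1 \<in> C"
    using R(1,2) by (auto simp: C lookup_one when_def zero_word_def)
  show "f + g \<in> C" if "f \<in> C" "g \<in> C"
    using that keys_add[of f g] by (fastforce simp: C lookup_add intro: R(3))
  show "- f \<in> C" if "f \<in> C"
    using that by (auto simp: C in_keys_iff intro: R(5))
  show "f * g \<in> C" if fg: "f \<in> C" "g \<in> C"
    unfolding C
  proof (intro conjI ballI allI)
    fix w assume "w \<in> Poly_Mapping.keys (f * g)"
    then obtain u v where "w = u + v" "u \<in> Poly_Mapping.keys f" "v \<in> Poly_Mapping.keys g"
      using keys_mult[of f g] by auto
    then show "set (letters w) \<subseteq> X"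
      using fg by (auto simp: C plus_word_def)
  next
    fix w
    show "Poly_Mapping.lookup (f * g) w \<in> R"
      using fg by (intro lookup_mult_closed R(1,3,4)) (auto simp: C)
  qed
qed

lemma free_algebra_ring:
  assumes R: "0 \<in> R" "1 \<in> R" "\<And>a b. a \<in> R \<Longrightarrow> b \<in> R \<Longrightarrow> a + b \<in> R"
    "\<And>a b. a \<in> R \<Longrightarrow> b \<in> R \<Longrightarrow> a * b \<in> R" "\<And>a. a \<in> R \<Longrightarrow> - a \<in> R"
  shows "ring (free_algebra X R)"
proof (rule ringI)
  note closed = free_algebra_closed[where X = X, OF R]
  show "abelian_group (free_algebra X R)"
  proof (rule abelian_groupI)
    fix f assume "f \<in> carrier (free_algebra X R)"
    then show "\<exists>g\<in>carrier (free_algebra X R).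
        g \<oplus>\<^bsub>free_algebra X R\<^esub> f = \<zero>\<^bsub>free_algebra X R\<^esub>"
      by (intro bexI[of _ "- f"] closed(5)) (simp_all add: free_algebra_simps)
  qed (auto simp: free_algebra_simps add_ac intro: closed(1,3))
  show "monoid (free_algebra X R)"
    by (rule monoidI) (auto simp: free_algebra_simps mult.assoc intro: closed(2,4))
qed (auto simp: free_algebra_simps distrib_left distrib_right)

lemma free_algebra_a_inv:
  fixes X :: "'x set" and R :: "'r::comm_ring_1 set"
  assumes "ring (free_algebra X R)" and f: "f \<in> carrier (free_algebra X R)"
  shows "\<ominus>\<^bsub>free_algebra X R\<^esub> f = - f"
proof -
  interpret ring "free_algebra X R" by fact
  have "f + (\<ominus>\<^bsub>free_algebra X R\<^esub> f) = 0"
    using r_neg[OF f] by (simp add: free_algebra_simps)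
  then show ?thesis by (simp add: eq_neg_iff_add_eq_0 add.commute)
qed

text \<open>
  The carrier of a free algebra is a subset of a type that already is a ring, so membership in a
  generated ideal can be handled with the operations of that type.
\<close>

lemma free_algebra_genideal:
  fixes X :: "'x set" and R :: "'r::comm_ring_1 set"
  assumes "ring (free_algebra X R)" and S: "S \<subseteq> carrier (free_algebra X R)"
  defines "A \<equiv> free_algebra X R"
  shows "S \<subseteq> Idl\<^bsub>A\<^esub> S" "Idl\<^bsub>A\<^esub> S \<subseteq> carrier A" "0 \<in> Idl\<^bsub>A\<^esub> S"
    "p \<in> Idl\<^bsub>A\<^esub> S \<Longrightarrow> q \<in> Idl\<^bsub>A\<^esub> S \<Longrightarrow> p + q \<in> Idl\<^bsub>A\<^esub> S"
    "p \<in> Idl\<^bsub>A\<^esub> S \<Longrightarrow> - p \<in> Idl\<^bsub>A\<^esub> S"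
    "p \<in> Idl\<^bsub>A\<^esub> S \<Longrightarrow> f \<in> carrier A \<Longrightarrow> f * p \<in> Idl\<^bsub>A\<^esub> S"
    "p \<in> Idl\<^bsub>A\<^esub> S \<Longrightarrow> f \<in> carrier A \<Longrightarrow> p * f \<in> Idl\<^bsub>A\<^esub> S"
proof -
  interpret ring A using assms(1) by (simp add: A_def)
  have S': "S \<subseteq> carrier A" using S by (simp add: A_def)
  interpret J: ideal "Idl\<^bsub>A\<^esub> S" A by (rule genideal_ideal[OF S'])
  note simps = free_algebra_simps[of X R, folded A_def]
  show "S \<subseteq> Idl\<^bsub>A\<^esub> S" by (rule genideal_self[OF S'])
  show sub: "Idl\<^bsub>A\<^esub> S \<subseteq> carrier A" by (rule J.a_subset)
  show "0 \<in> Idl\<^bsub>A\<^esub> S" using J.zero_closed by (simp add: simps)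
  show "p + q \<in> Idl\<^bsub>A\<^esub> S" if "p \<in> Idl\<^bsub>A\<^esub> S" "q \<in> Idl\<^bsub>A\<^esub> S"
    using J.a_closed[OF that] by (simp add: simps)
  show "- p \<in> Idl\<^bsub>A\<^esub> S" if "p \<in> Idl\<^bsub>A\<^esub> S"
    using J.a_inv_closed[OF that] free_algebra_a_inv[OF assms(1), folded A_def] sub that by auto
  show "f * p \<in> Idl\<^bsub>A\<^esub> S" if "p \<in> Idl\<^bsub>A\<^esub> S" "f \<in> carrier A"
    using J.I_l_closed[OF that] by (simp add: simps)
  show "p * f \<in> Idl\<^bsub>A\<^esub> S" if "p \<in> Idl\<^bsub>A\<^esub> S" "f \<in> carrier A"
    using J.I_r_closed[OF that] by (simp add: simps)
qed

lemma free_algebra_genideal_minimal: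
  fixes X :: "'x set" and R :: "'r::comm_ring_1 set"
  assumes ring: "ring (free_algebra X R)"
  defines "A \<equiv> free_algebra X R"
  assumes N: "N \<subseteq> carrier A" "0 \<in> N" "S \<subseteq> N"
    and add: "\<And>p q. p \<in> N \<Longrightarrow> q \<in> N \<Longrightarrow> p + q \<in> N"
    and minus: "\<And>p. p \<in> N \<Longrightarrow> - p \<in> N"
    and mult: "\<And>p f. p \<in> N \<Longrightarrow> f \<in> carrier A \<Longrightarrow> f * p \<in> N"
      "\<And>p f. p \<in> N \<Longrightarrow> f \<in> carrier A \<Longrightarrow> p * f \<in> N"
  shows "Idl\<^bsub>A\<^esub> S \<subseteq> N"
proof -
  interpret ring A using ring by (simp add: A_def)
  note simps = free_algebra_simps[of X R, folded A_def]
  have "subgroup N (add_monoid A)"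
  proof (rule group.subgroupI)
    show "group (add_monoid A)" by (rule a_group)
    fix p assume p: "p \<in> N"
    then have "inv\<^bsub>add_monoid A\<^esub> p = - p"
      using free_algebra_a_inv[OF ring, folded A_def, of p] N(1) by (auto simp: a_inv_def)
    then show "inv\<^bsub>add_monoid A\<^esub> p \<in> N" using minus[OF p] by simp
  qed (use N add in \<open>auto simp: simps\<close>)
  then have "ideal N A"
    by (rule idealI[OF ring_axioms]) (simp_all add: simps mult)
  then show ?thesis
    by (rule genideal_minimal[OF _ N(3)])
qed

lemma polynomials_closed:
  fixes V :: "'v set"
  defines "R \<equiv> polynomials V :: (('v \<Rightarrow>\<^sub>0 nat) \<Rightarrow>\<^sub>0 'r::comm_ring_1) set"
  shows "0 \<in> R" "1 \<in> R" "f \<in> R \<Longrightarrow> g \<in> R \<Longrightarrow> f + g \<in> R" "f \<in> R \<Longrightarrow> g \<in> R \<Longrightarrow> f * g \<in> R"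
    "f \<in> R \<Longrightarrow> - f \<in> R"
proof -
  show "0 \<in> R" "1 \<in> R"
    by (simp_all add: R_def polynomials_def)
  show "f + g \<in> R" if "f \<in> R" "g \<in> R"
    using that keys_add[of f g] by (fastforce simp: R_def polynomials_def)
  show "- f \<in> R" if "f \<in> R"
    using that by (simp add: R_def polynomials_def in_keys_iff)
  show "f * g \<in> R" if "f \<in> R" "g \<in> R"
    unfolding R_def polynomials_def
  proof (intro CollectI ballI)
    fix m assume "m \<in> Poly_Mapping.keys (f * g)"
    then obtain a b where "m = a + b" "a \<in> Poly_Mapping.keys f" "b \<in> Poly_Mapping.keys g"
      using keys_mult[of f g] by auto
    then show "Poly_Mapping.keys m \<subseteq> V"
      using that keys_add[of a b] unfolding R_def polynomials_def by blast
  qed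
qed

section \<open>Relations in the enveloping algebra\<close>

lemma scalar_central:
  fixes p :: "'k::monoid_add \<Rightarrow>\<^sub>0 'r::comm_ring_1"
  shows "Poly_Mapping.single 0 a * p = p * Poly_Mapping.single 0 a"
  by (induction p rule: poly_mapping_singles_induct)
    (simp_all add: mult_single distrib_left distrib_right mult.commute)

lemma scalar_left_commute:
  fixes p q :: "'k::monoid_add \<Rightarrow>\<^sub>0 'r::comm_ring_1"
  shows "p * (Poly_Mapping.single 0 a * q) = Poly_Mapping.single 0 a * (p * q)"
  by (simp only: mult.assoc[symmetric] scalar_central[of a p])

context complex_lie_algebra
begin

definition monomial :: "'g list \<Rightarrow> 'g word \<Rightarrow>\<^sub>0 complex"
  where "monomial X = Poly_Mapping.single (Word X) 1"

abbreviation scalar :: "complex \<Rightarrow> 'g word \<Rightarrow>\<^sub>0 complex"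
  where "scalar a \<equiv> Poly_Mapping.single 0 a"

definition relations_ideal :: "('g word \<Rightarrow>\<^sub>0 complex) set"
  where "relations_ideal = Idl\<^bsub>word_algebra\<^esub> enveloping_relations"

lemma monomial_append: "monomial (X @ Y) = monomial X * monomial Y"
  by (simp add: monomial_def mult_single plus_word_def)

lemma monomial_Nil: "monomial [] = 1"
  by (simp add: monomial_def flip: zero_word_def)

lemma letter_eq_monomial: "letter x = monomial [x]"
  by (simp add: letter_def monomial_def)

lemma single_eq_monomial: "Poly_Mapping.single w a = scalar a * monomial (letters w)"
  by (simp add: monomial_def mult_single)

lemma word_algebra_ring: "ring word_algebra"
  by (rule free_algebra_ring) auto

lemma word_algebra_carrier: "carrier word_algebra = UNIV"
  by (auto simp: free_algebra_def)

lemma relations_ideal_closed: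
  shows "p \<in> enveloping_relations \<Longrightarrow> p \<in> relations_ideal"
    "0 \<in> relations_ideal"
    "p \<in> relations_ideal \<Longrightarrow> q \<in> relations_ideal \<Longrightarrow> p + q \<in> relations_ideal"
    "p \<in> relations_ideal \<Longrightarrow> - p \<in> relations_ideal"
    "p \<in> relations_ideal \<Longrightarrow> f * p \<in> relations_ideal"
    "p \<in> relations_ideal \<Longrightarrow> p * f \<in> relations_ideal"
  using free_algebra_genideal[OF word_algebra_ring, of enveloping_relations]
  by (auto simp: word_algebra_carrier relations_ideal_def)

lemma relations_ideal_diff:
  "p \<in> relations_ideal \<Longrightarrow> q \<in> relations_ideal \<Longrightarrow> p - q \<in> relations_ideal"
  using relations_ideal_closed(3)[of p "- q"] relations_ideal_closed(4)[of q] by simp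

lemma relations_ideal_trans:
  "p - q \<in> relations_ideal \<Longrightarrow> q - r \<in> relations_ideal \<Longrightarrow> p - r \<in> relations_ideal"
  using relations_ideal_closed(3)[of "p - q" "q - r"] by simp

lemma relations_ideal_commute: "p - q \<in> relations_ideal \<longleftrightarrow> q - p \<in> relations_ideal"
  using relations_ideal_closed(4)[of "p - q"] relations_ideal_closed(4)[of "q - p"] by auto

lemma relations_ideal_sum:
  "(\<And>i. i \<in> S \<Longrightarrow> p i \<in> relations_ideal) \<Longrightarrow> sum p S \<in> relations_ideal"
  by (induction S rule: infinite_finite_induct) (auto intro: relations_ideal_closed)

lemma monomial_relations:
  shows "monomial (u @ (x + y) # v) - (monomial (u @ x # v) + monomial (u @ y # v)) \<in> relations_ideal"
    and "monomial (u @ scale a x # v) - scalar a * monomial (u @ x # v) \<in> relations_ideal"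
    and "monomial (u @ x # y # v) - monomial (u @ y # x # v) - monomial (u @ bracket x y # v)
      \<in> relations_ideal"
proof -
  have split: "monomial (u @ z # v) = monomial u * letter z * monomial v" for z
    by (simp add: letter_eq_monomial flip: monomial_append)
  have split2: "monomial (u @ x # y # v) = monomial u * (letter x * letter y) * monomial v" for x y
    by (simp add: letter_eq_monomial flip: monomial_append)
  have in_context: "monomial u * r * monomial v \<in> relations_ideal" if "r \<in> enveloping_relations" for r
    using that by (intro relations_ideal_closed)
  have "letter (x + y) - (letter x + letter y) \<in> enveloping_relations"
    unfolding enveloping_relations_def by blast
  from in_context[OF this]
  show "monomial (u @ (x + y) # v) - (monomial (u @ x # v) + monomial (u @ y # v)) \<in> relations_ideal"
    unfolding split by (simp add: left_diff_distrib right_diff_distrib distrib_left distrib_right)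
  have "monomial u * (scalar a * letter x) * monomial v
      = scalar a * (monomial u * letter x * monomial v)"
    by (simp only: scalar_left_commute mult.assoc)
  then show "monomial (u @ scale a x # v) - scalar a * monomial (u @ x # v) \<in> relations_ideal"
    using in_context[of "letter (scale a x) - scalar a * letter x"]
    by (auto simp: split enveloping_relations_def left_diff_distrib right_diff_distrib)
  have "letter x * letter y - letter y * letter x - letter (bracket x y) \<in> enveloping_relations"
    unfolding enveloping_relations_def by blast
  from in_context[OF this]
  show "monomial (u @ x # y # v) - monomial (u @ y # x # v) - monomial (u @ bracket x y # v)
      \<in> relations_ideal"
    unfolding split split2 by (simp add: left_diff_distrib right_diff_distrib)
qed

lemma monomial_linear_combination:
  assumes "finite S"
  shows "monomial (u @ (\<Sum>b\<in>S. scale (c b) b) # v) - (\<Sum>b\<in>S. scalar (c b) * monomial (u @ b # v))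
    \<in> relations_ideal"
  using assms
proof (induction S rule: finite_induct)
  case empty
  show ?case using monomial_relations(2)[of u 0 0 v] by simp
next
  case (insert b S)
  let ?x = "\<Sum>b\<in>S. scale (c b) b"
  have "monomial (u @ (scale (c b) b + ?x) # v) - (monomial (u @ scale (c b) b # v) + monomial (u @ ?x # v))
      + (monomial (u @ scale (c b) b # v) - scalar (c b) * monomial (u @ b # v))
      + (monomial (u @ ?x # v) - (\<Sum>b\<in>S. scalar (c b) * monomial (u @ b # v))) \<in> relations_ideal"
    by (intro relations_ideal_closed(3) monomial_relations insert.IH)
  then show ?case using insert.hyps by (simp add: algebra_simps)
qed

lemma relations_ideal_is_ideal: "ideal relations_ideal word_algebra"
  unfolding relations_ideal_def
  by (rule ring.genideal_ideal[OF word_algebra_ring]) (simp add: word_algebra_carrier)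

lemma env_class_eq_iff: "env_class f = env_class g \<longleftrightarrow> f - g \<in> relations_ideal"
proof -
  interpret ring word_algebra by (rule word_algebra_ring)
  have "f \<ominus>\<^bsub>word_algebra\<^esub> g = f - g"
    using free_algebra_a_inv[OF word_algebra_ring, of g]
    by (simp add: a_minus_def word_algebra_carrier free_algebra_simps)
  then show ?thesis
    using quotient_eq_iff_same_a_r_cos[OF relations_ideal_is_ideal, of f g]
    by (auto simp: env_class_def word_algebra_carrier relations_ideal_def)
qed

lemma env_class_ring_hom: "env_class \<in> ring_hom word_algebra enveloping_algebra"
  using ideal.rcos_ring_hom[OF relations_ideal_is_ideal]
  unfolding env_class_def[abs_def] enveloping_algebra_def relations_ideal_def .

lemma env_class_simps:
  "env_class f \<otimes>\<^bsub>enveloping_algebra\<^esub> env_class g = env_class (f * g)"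
  "env_class f \<oplus>\<^bsub>enveloping_algebra\<^esub> env_class g = env_class (f + g)"
  "\<one>\<^bsub>enveloping_algebra\<^esub> = env_class 1"
  "\<zero>\<^bsub>enveloping_algebra\<^esub> = env_class 0"
  "env_class f \<in> carrier enveloping_algebra"
proof -
  note hom = ring_hom_memE[OF env_class_ring_hom, unfolded word_algebra_carrier, simplified free_algebra_simps]
  show "env_class f \<otimes>\<^bsub>enveloping_algebra\<^esub> env_class g = env_class (f * g)"
    "env_class f \<oplus>\<^bsub>enveloping_algebra\<^esub> env_class g = env_class (f + g)"
    "\<one>\<^bsub>enveloping_algebra\<^esub> = env_class 1"
    "env_class f \<in> carrier enveloping_algebra"
    using hom by simp_all
  interpret ring word_algebra by (rule word_algebra_ring)
  have "relations_ideal +>\<^bsub>word_algebra\<^esub> 0 = relations_ideal"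
    using a_rcos_zero[OF relations_ideal_is_ideal relations_ideal_closed(2)] .
  then show "\<zero>\<^bsub>enveloping_algebra\<^esub> = env_class 0"
    by (simp add: enveloping_algebra_def env_class_def FactRing_def relations_ideal_def)
qed

section \<open>Functionals on the enveloping algebra\<close>

text \<open>
  Linear functionals on \<open>U(\<gg>)\<close>, described by their values on words: the three conditions say that
  the linear extension kills each defining relation placed between two arbitrary words \<open>u\<close> and \<open>v\<close>.
\<close>

definition lie_functional :: "('g list \<Rightarrow> complex) \<Rightarrow> bool"
  where "lie_functional f \<longleftrightarrow>
    (\<forall>u v x y. f (u @ (x + y) # v) = f (u @ x # v) + f (u @ y # v)) \<and>
    (\<forall>u v a x. f (u @ scale a x # v) = a * f (u @ x # v)) \<and>
    (\<forall>u v x y. f (u @ x # y # v) - f (u @ y # x # v) = f (u @ bracket x y # v))"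

definition linear_extension :: "('g list \<Rightarrow> complex) \<Rightarrow> ('g word \<Rightarrow>\<^sub>0 complex) \<Rightarrow> complex"
  where "linear_extension f = additive_extension (\<lambda>w a. a * f (letters w))"

lemma linear_extension_zero: "linear_extension f 0 = 0"
  by (simp add: linear_extension_def)

lemma linear_extension_add: "linear_extension f (p + q) = linear_extension f p + linear_extension f q"
  unfolding linear_extension_def by (rule additive_extension_add) (simp_all add: distrib_right)

lemma linear_extension_scalar: "linear_extension f (scalar a * p) = a * linear_extension f p"
proof (induction p rule: poly_mapping_singles_induct)
  case (single k)
  then show ?case by (simp add: linear_extension_def mult_single additive_extension_single)
qed (simp_all add: linear_extension_add linear_extension_zero distrib_left)

lemma linear_extension_monomial: "linear_extension f (monomial X) = f X"
  by (simp add: linear_extension_def monomial_def additive_extension_single)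

lemma linear_extension_minus: "linear_extension f (- p) = - linear_extension f p"
  using linear_extension_add[of f p "- p"] by (simp add: linear_extension_zero eq_neg_iff_add_eq_0 add.commute)

lemma linear_extension_diff: "linear_extension f (p - q) = linear_extension f p - linear_extension f q"
  using linear_extension_add[of f p "- q"] by (simp add: linear_extension_minus)

lemma linear_extension_sum: "linear_extension f (sum p S) = (\<Sum>i\<in>S. linear_extension f (p i))"
  by (induction S rule: infinite_finite_induct) (simp_all add: linear_extension_add linear_extension_zero)

text \<open>
  The elements that are killed together with all their multiples by words on both sides form a
  two-sided ideal, and this ideal contains the defining relations.
\<close>

lemma lie_functional_vanishes:
  assumes f: "lie_functional f" and "p \<in> relations_ideal"
  shows "linear_extension f p = 0"
proof -
  \<comment> \<open>The values of \<open>f\<close> on the two-sided multiples of \<open>p\<close> by words.\<close>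
  define L where "L u v p = linear_extension f (monomial u * p * monomial v)" for u v p
  have L: "L u v 0 = 0" "L u v (p + q) = L u v p + L u v q" "L u v (- p) = - L u v p"
    "L u v (p - q) = L u v p - L u v q" for u v p q
    by (simp_all add: L_def linear_extension_zero linear_extension_add linear_extension_minus
        linear_extension_diff distrib_left distrib_right left_diff_distrib right_diff_distrib)
  have L_scalar: "L u v (scalar a * p) = a * L u v p" for u v a p
  proof -
    have "monomial u * (scalar a * p) * monomial v = scalar a * (monomial u * p * monomial v)"
      by (simp only: scalar_left_commute mult.assoc)
    then show ?thesis by (simp add: L_def linear_extension_scalar)
  qed
  have L_monomial: "L u v (monomial X) = f (u @ X @ v)" for u v X
    unfolding L_def monomial_append[symmetric] linear_extension_monomial by simp
  define N where "N = {p. \<forall>u v. L u v p = 0}"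
  have "relations_ideal \<subseteq> N"
    unfolding relations_ideal_def
  proof (rule free_algebra_genideal_minimal[OF word_algebra_ring])
    show "enveloping_relations \<subseteq> N"
    proof
      fix r assume "r \<in> enveloping_relations"
      then consider (add) x y where "r = monomial [x + y] - (monomial [x] + monomial [y])"
        | (scale) a x where "r = monomial [scale a x] - scalar a * monomial [x]"
        | (bracket) x y where "r = monomial [x, y] - monomial [y, x] - monomial [bracket x y]"
        unfolding enveloping_relations_def letter_eq_monomial monomial_append[symmetric] append.simps
        by blast
      then show "r \<in> N"
        using f by cases (simp_all add: N_def L L_scalar L_monomial lie_functional_def)
    qed
    fix p q assume p: "p \<in> N"
    show "p + q \<in> N" if "q \<in> N"
      using p that by (simp add: N_def L)
    show "- p \<in> N"
      using p by (simp add: N_def L)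
    show "g * p \<in> N" for g
    proof (induction g rule: poly_mapping_singles_induct)
      case (single k)
      have "L u v (monomial X * p) = L (u @ X) v p" for u v X
        by (simp add: L_def monomial_append mult.assoc)
      then show ?case using p
        by (simp add: N_def single_eq_monomial[of k] mult.assoc[of "scalar _"] L_scalar)
    qed (simp_all add: N_def L distrib_right)
    show "p * g \<in> N" for g
    proof (induction g rule: poly_mapping_singles_induct)
      case (single k)
      have "p * (scalar a * q) = scalar a * (p * q)" for a q
        by (simp only: scalar_left_commute mult.assoc)
      moreover have "L u v (p * monomial X) = L u (X @ v) p" for u v X
        by (simp add: L_def monomial_append mult.assoc)
      ultimately show ?case using p
        by (simp add: N_def single_eq_monomial[of k] L_scalar)
    qed (simp_all add: N_def L distrib_left)
  qed (simp_all add: word_algebra_carrier N_def L)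
  then have "L [] [] p = 0"
    using assms(2) unfolding N_def by blast
  then show ?thesis by (simp add: L_def monomial_Nil)
qed

end

section \<open>Independence of monomials\<close>

text \<open>
  The product of functionals dual to the comultiplication \<open>x \<mapsto> x \<otimes> 1 + 1 \<otimes> x\<close> of \<open>U(\<gg>)\<close>: the sum, over
  all ways of distributing the letters of the word among the two factors, of the products of the
  two values. The recursion decides where the first letter goes.
\<close>

primrec shuffle :: "'a list \<Rightarrow> ('a list \<Rightarrow> 'b::comm_ring_1) \<Rightarrow> ('a list \<Rightarrow> 'b) \<Rightarrow> 'b"
  where "shuffle [] f g = f [] * g []"
  | "shuffle (x # X) f g = shuffle X (\<lambda>Y. f (x # Y)) g + shuffle X f (\<lambda>Y. g (x # Y))"

lemma shuffle_bilinear: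
  "shuffle X (\<lambda>Y. f Y + f' Y) g = shuffle X f g + shuffle X f' g"
  "shuffle X g (\<lambda>Y. f Y + f' Y) = shuffle X g f + shuffle X g f'"
  "shuffle X (\<lambda>Y. f Y - f' Y) g = shuffle X f g - shuffle X f' g"
  "shuffle X g (\<lambda>Y. f Y - f' Y) = shuffle X g f - shuffle X g f'"
  "shuffle X (\<lambda>Y. a * f Y) g = a * shuffle X f g"
  "shuffle X g (\<lambda>Y. a * f Y) = a * shuffle X g f"
  by (induction X arbitrary: f f' g) (simp_all add: algebra_simps)

text \<open>
  Call a functional of order at least \<open>k\<close> if it vanishes on all words with fewer than \<open>k\<close> letters. On
  such a short word, whatever share of the letters \<open>g\<close> receives is too short as well.
\<close>

lemma shuffle_below_order:
  assumes "\<And>X. length X < k \<Longrightarrow> g X = 0" and "length X < k"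
  shows "shuffle X f g = 0"
  using assms
proof (induction X arbitrary: f g k)
  case (Cons x X)
  have "shuffle X (\<lambda>Y. f (x # Y)) g = 0"
    using Cons.prems by (intro Cons.IH[of k]) auto
  moreover have "shuffle X f (\<lambda>Y. g (x # Y)) = 0"
    using Cons.prems by (intro Cons.IH[of "k - 1"]) auto
  ultimately show ?case by simp
qed auto

text \<open>
  On a word of length \<open>k\<close> the factor \<open>g\<close> has to receive every letter.
\<close>

lemma shuffle_at_order:
  assumes "\<And>X. length X < k \<Longrightarrow> g X = 0" and "length X = k"
  shows "shuffle X f g = f [] * g X"
  using assms
proof (induction X arbitrary: f g k)
  case (Cons x X)
  have "shuffle X (\<lambda>Y. f (x # Y)) g = 0"
    using Cons.prems by (intro shuffle_below_order[of k]) auto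
  moreover have "shuffle X f (\<lambda>Y. g (x # Y)) = f [] * g (x # X)"
    using Cons.prems by (intro Cons.IH[of "k - 1"]) auto
  ultimately show ?case by simp
qed auto

text \<open>
  On a word of length \<open>k + 1\<close> exactly one letter goes to \<open>f\<close>, and \<open>f\<close> detects the letter \<open>b\<close>. So the
  value is the sum of \<open>g\<close> over the words left after deleting one occurrence of \<open>b\<close>. The values of \<open>g\<close>
  are natural numbers, hence nothing cancels in this sum. The predicate \<open>Q\<close> is arbitrary because in the
  induction it is replaced by its translate along the first letter.
\<close>

lemma shuffle_leading_term:
  fixes f g :: "'a list \<Rightarrow> 'b::{comm_ring_1, ring_char_0}"
  assumes low: "\<And>X. length X < k \<Longrightarrow> g X = 0" and f0: "f [] = 0"
    and f1: "\<And>x. x \<in> B \<Longrightarrow> f [x] = (if x = b then 1 else 0)"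
    and g: "\<And>X. set X \<subseteq> B \<Longrightarrow> length X = k \<Longrightarrow> \<exists>n::nat. g X = of_nat n \<and> (n > 0 \<longleftrightarrow> Q (mset X))"
    and X: "length X = Suc k" "set X \<subseteq> B"
  shows "\<exists>n::nat. shuffle X f g = of_nat n \<and> (n > 0 \<longleftrightarrow> b \<in># mset X \<and> Q (mset X - {#b#}))"
  using X low g
proof (induction X arbitrary: g k Q)
  case (Cons x X)
  have first: "shuffle X (\<lambda>Y. f (x # Y)) g = f [x] * g X"
    using Cons.prems(1,3) by (intro shuffle_at_order[of k]) auto
  obtain m :: nat where m: "g X = of_nat m" "m > 0 \<longleftrightarrow> Q (mset X)"
    using Cons.prems(4)[of X] Cons.prems(1,2) by auto
  have "\<exists>n::nat. shuffle X f (\<lambda>Y. g (x # Y)) = of_nat n \<and>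
      (n > 0 \<longleftrightarrow> b \<in># mset X \<and> Q (add_mset x (mset X - {#b#})))"
  proof (cases k)
    case 0
    then show ?thesis using Cons.prems(1) f0 by (intro exI[of _ 0]) simp
  next
    case (Suc k')
    show ?thesis
    proof (rule Cons.IH[of k' _ "\<lambda>M. Q (add_mset x M)"])
      show "length X = Suc k'" "set X \<subseteq> B" using Cons.prems(1,2) Suc by auto
      show "g (x # Y) = 0" if "length Y < k'" for Y using Cons.prems(3) that Suc by simp
      show "\<exists>n::nat. g (x # Y) = of_nat n \<and> (n > 0 \<longleftrightarrow> Q (add_mset x (mset Y)))"
        if "set Y \<subseteq> B" "length Y = k'" for Y
        using Cons.prems(4)[of "x # Y"] Cons.prems(2) that Suc by simp
    qed
  qed
  then obtain n :: nat where n: "shuffle X f (\<lambda>Y. g (x # Y)) = of_nat n"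
    "n > 0 \<longleftrightarrow> b \<in># mset X \<and> Q (add_mset x (mset X - {#b#}))" by blast
  show ?case
  proof (cases "x = b")
    case True
    have "b \<in># mset X \<Longrightarrow> add_mset b (mset X - {#b#}) = mset X" by simp
    then show ?thesis
      using True first m n f1[of x] Cons.prems(2) by (intro exI[of _ "m + n"]) auto
  next
    case False
    have "b \<in># mset X \<Longrightarrow> add_mset x (mset X - {#b#}) = add_mset x (mset X) - {#b#}"
      using False by (simp add: multiset_eq_iff)
    then show ?thesis
      using False first n f1[of x] Cons.prems(2) by (intro exI[of _ n]) auto
  qed
qed simp

context complex_lie_algebra
begin

lemma bracket_zero_left: "bracket 0 x = 0"
  using bracket_scale_left[of 0 0 x] by simp

lemma bracket_zero_right: "bracket x 0 = 0"
  using bracket_scale_right[of x 0 0] by simp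

lemma bracket_anticommute: "bracket y x = - bracket x y"
proof -
  have "bracket x y + bracket y x = 0"
    using bracket_self[of "x + y"]
    unfolding bracket_add_left bracket_add_right bracket_self[of x] bracket_self[of y] by (simp add: add.commute)
  then show ?thesis by (simp add: eq_neg_iff_add_eq_0 add.commute)
qed

lemma bracket_minus_right: "bracket x (- y) = - bracket x y"
  using bracket_scale_right[of x "-1" y] by simp

lemma bracket_derivation: "bracket x (bracket y z) = bracket y (bracket x z) + bracket (bracket x y) z"
proof -
  have "bracket y (bracket z x) = - bracket y (bracket x z)"
    using bracket_anticommute[of z x] by (simp add: bracket_minus_right)
  moreover have "bracket z (bracket x y) = - bracket (bracket x y) z"
    by (rule bracket_anticommute)
  ultimately have "bracket x (bracket y z) - bracket y (bracket x z) - bracket (bracket x y) z = 0"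
    using jacobi[of x y z] by simp
  then show ?thesis by (simp add: algebra_simps)
qed

lemma lie_functional_Cons: "lie_functional f \<Longrightarrow> lie_functional (\<lambda>Y. f (x # Y))"
  unfolding lie_functional_def by (metis append_Cons)

text \<open>
  Letters act on a product of functionals by the Leibniz rule. In the difference between \<open>xy\<close> and \<open>yx\<close>
  the mixed terms, where \<open>x\<close> and \<open>y\<close> go to different factors, cancel, and what remains is the action of
  \<open>[x, y]\<close> on each factor.
\<close>

lemma lie_functional_shuffle:
  assumes "lie_functional f" and "lie_functional g"
  shows "lie_functional (\<lambda>X. shuffle X f g)"
proof -
  have head: "f ((x + y) # v) = f (x # v) + f (y # v)" "f (scale a x # v) = a * f (x # v)"
    "f (bracket x y # v) = f (x # y # v) - f (y # x # v)" if "lie_functional f" for f x y a v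
    using that[unfolded lie_functional_def, THEN conjunct1, rule_format, of "[]" x y v]
      that[unfolded lie_functional_def, THEN conjunct2, THEN conjunct1, rule_format, of "[]" a x v]
      that[unfolded lie_functional_def, THEN conjunct2, THEN conjunct2, rule_format, of "[]" x y v]
    by simp_all
  have "shuffle (u @ (x + y) # v) f g = shuffle (u @ x # v) f g + shuffle (u @ y # v) f g" for u v x y
    using assms
    by (induction u arbitrary: f g) (simp_all add: head shuffle_bilinear lie_functional_Cons)
  moreover have "shuffle (u @ scale a x # v) f g = a * shuffle (u @ x # v) f g" for u v a x
    using assms
    by (induction u arbitrary: f g) (simp_all add: head shuffle_bilinear lie_functional_Cons distrib_left)
  moreover have "shuffle (u @ x # y # v) f g - shuffle (u @ y # x # v) f g = shuffle (u @ bracket x y # v) f g" for u v x y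
    using assms
  proof (induction u arbitrary: f g)
    case (Cons z u)
    have "shuffle (u @ x # y # v) (\<lambda>Y. f (z # Y)) g - shuffle (u @ y # x # v) (\<lambda>Y. f (z # Y)) g
        = shuffle (u @ bracket x y # v) (\<lambda>Y. f (z # Y)) g"
      "shuffle (u @ x # y # v) f (\<lambda>Y. g (z # Y)) - shuffle (u @ y # x # v) f (\<lambda>Y. g (z # Y))
        = shuffle (u @ bracket x y # v) f (\<lambda>Y. g (z # Y))"
      using Cons.IH Cons.prems lie_functional_Cons by blast+
    then show ?case by (simp add: algebra_simps)
  qed (simp add: head shuffle_bilinear)
  ultimately show ?thesis unfolding lie_functional_def by blast
qed

text \<open>
  The empty product is the counit of \<open>U(\<gg>)\<close>.
\<close>

primrec dual_functional :: "('g \<Rightarrow> 'g list \<Rightarrow> complex) \<Rightarrow> 'g list \<Rightarrow> 'g list \<Rightarrow> complex"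
  where "dual_functional l [] = (\<lambda>X. if X = [] then 1 else 0)"
  | "dual_functional l (b # bs) = (\<lambda>X. shuffle X (l b) (dual_functional l bs))"

text \<open>
  The independence half of the Poincare-Birkhoff-Witt theorem. In a vanishing combination, take a
  word of maximal length among those with nonzero coefficient. The functional dual to its letters
  kills all shorter words, by \<open>shuffle_below_order\<close>, and all words of the same length with other letters,
  by \<open>shuffle_leading_term\<close>, but takes a positive value on the word itself.
\<close>

lemma monomials_independent:
  assumes l: "\<And>b. b \<in> B \<Longrightarrow> lie_functional (l b)" "\<And>b. b \<in> B \<Longrightarrow> l b [] = 0"
    "\<And>b x. b \<in> B \<Longrightarrow> x \<in> B \<Longrightarrow> l b [x] = (if x = b then 1 else 0)"
    and T: "finite T" "\<And>i. i \<in> T \<Longrightarrow> set (W i) \<subseteq> B" "inj_on (\<lambda>i. mset (W i)) T"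
    and zero: "(\<Sum>i\<in>T. scalar (a i) * monomial (W i)) \<in> relations_ideal"
    and "i \<in> T"
  shows "a i = 0"
proof -
  have lie: "lie_functional (dual_functional l bs)" if "set bs \<subseteq> B" for bs
    using that
  proof (induction bs)
    case Nil
    show ?case by (simp add: lie_functional_def)
  next
    case (Cons b bs)
    then show ?case using l(1) by (simp add: lie_functional_shuffle)
  qed
  have low: "dual_functional l bs X = 0" if "set bs \<subseteq> B" "length X < length bs" for bs X
    using that
  proof (induction bs arbitrary: X)
    case (Cons b bs)
    have IH: "\<And>X. length X < length bs \<Longrightarrow> dual_functional l bs X = 0"
      using Cons by simp
    consider "length X < length bs" | "length X = length bs"
      using Cons.prems by fastforce
    then show ?case
    proof cases
      case 1
      then show ?thesis using shuffle_below_order[OF IH] by simp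
    next
      case 2
      then show ?thesis using shuffle_at_order[of "length bs" "dual_functional l bs" X "l b", OF IH] l(2)[of b] Cons.prems by simp
    qed
  qed simp
  have leading: "\<exists>n::nat. dual_functional l bs X = of_nat n \<and> (n > 0 \<longleftrightarrow> mset X = mset bs)"
    if "set bs \<subseteq> B" "set X \<subseteq> B" "length X = length bs" for bs X
    using that
  proof (induction bs arbitrary: X)
    case Nil
    then show ?case by (intro exI[of _ 1]) simp
  next
    case (Cons b bs)
    have "\<exists>n::nat. shuffle X (l b) (dual_functional l bs) = of_nat n \<and>
        (n > 0 \<longleftrightarrow> b \<in># mset X \<and> mset X - {#b#} = mset bs)"
      by (rule shuffle_leading_term[where k = "length bs" and B = B])
        (use Cons low l in auto)
    moreover have "b \<in># mset X \<and> mset X - {#b#} = mset bs \<longleftrightarrow> mset X = mset (b # bs)"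
      by (metis add_mset_remove_trivial insert_DiffM mset.simps(2) union_single_eq_member)
    ultimately show ?case by simp
  qed
  show "a i = 0"
  proof (rule ccontr)
    assume "a i \<noteq> 0"
    define T' where "T' = {i \<in> T. a i \<noteq> 0}"
    define n where "n = Max ((\<lambda>i. length (W i)) ` T')"
    have T': "finite T'" "T' \<noteq> {}" using T(1) \<open>i \<in> T\<close> \<open>a i \<noteq> 0\<close> by (auto simp: T'_def)
    then have "n \<in> (\<lambda>i. length (W i)) ` T'" unfolding n_def by (intro Max_in) auto
    then obtain j where j: "j \<in> T'" "length (W j) = n" by auto
    have le: "length (W i) \<le> n" if "i \<in> T'" for i
      unfolding n_def using that T'(1) by (intro Max_ge) auto
    have jT: "j \<in> T" "set (W j) \<subseteq> B" using j T(2) by (auto simp: T'_def)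
    let ?f = "dual_functional l (W j)"
    have "0 = linear_extension ?f (\<Sum>i\<in>T. scalar (a i) * monomial (W i))"
      using lie_functional_vanishes[OF lie[OF jT(2)] zero] by simp
    also have "\<dots> = (\<Sum>i\<in>T. a i * ?f (W i))"
      by (simp add: linear_extension_sum linear_extension_scalar linear_extension_monomial)
    also have "\<dots> = (\<Sum>i\<in>T. if i = j then a j * ?f (W j) else 0)"
    proof (rule sum.cong)
      fix i assume i: "i \<in> T"
      show "a i * ?f (W i) = (if i = j then a j * ?f (W j) else 0)"
      proof (cases "i = j \<or> a i = 0")
        case False
        then have "length (W i) \<le> length (W j)" using le i j by (auto simp: T'_def)
        moreover have "mset (W i) \<noteq> mset (W j)"
          using False T(3) i jT by (auto dest: inj_onD)
        ultimately have "?f (W i) = 0"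
          using low[OF jT(2), of "W i"] leading[OF jT(2) T(2)[OF i]]
          by (cases "length (W i) = length (W j)") auto
        then show ?thesis using False by simp
      qed auto
    qed simp
    also have "\<dots> = a j * ?f (W j)"
      using T(1) jT by simp
    finally have "?f (W j) = 0" using j(1) by (simp add: T'_def)
    moreover obtain m :: nat where "?f (W j) = of_nat m" "m > 0"
      using leading[OF jT(2) jT(2)] by auto
    ultimately show False by simp
  qed
qed

lemma lie_functional_linear_combination:
  assumes "\<And>i. i \<in> S \<Longrightarrow> lie_functional (f i)"
  shows "lie_functional (\<lambda>X. \<Sum>i\<in>S. c i * f i X)"
  using assms
proof (induction S rule: infinite_finite_induct)
  case (insert i S)
  then have 1: "lie_functional (\<lambda>X. \<Sum>i\<in>S. c i * f i X)" and 2: "lie_functional (f i)" by simp_all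
  show ?case
    unfolding lie_functional_def sum.insert[OF insert.hyps]
    using 1[unfolded lie_functional_def] 2[unfolded lie_functional_def]
    by (simp add: distrib_left right_diff_distrib[symmetric] add_diff_add mult.left_commute)
qed (simp_all add: lie_functional_def)

text \<open>
  A matrix coefficient of the adjoint representation, changed to \<open>0\<close> on the empty word. The change is
  harmless because only nonempty words occur in the defining relations; it makes the functional of
  order at least one.
\<close>

definition coefficient_functional :: "'g set \<Rightarrow> 'g \<Rightarrow> 'g \<Rightarrow> 'g list \<Rightarrow> complex"
  where "coefficient_functional B b w X = (if X = [] then 0 else representation B (foldr bracket X w) b)"

text \<open>
  By the Jacobi identity \<open>ad\<close> is a representation.
\<close>

lemma lie_functional_coefficient:
  assumes B: "independent B" "span B = UNIV"
  shows "lie_functional (coefficient_functional B b w)"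
proof -
  have fold_add: "foldr bracket u (x + y) = foldr bracket u x + foldr bracket u y"
    and fold_scale: "foldr bracket u (scale a x) = scale a (foldr bracket u x)" for u x y a
    by (induction u) (simp_all add: bracket_add_right bracket_scale_right)
  have fold_diff: "foldr bracket u (x - y) = foldr bracket u x - foldr bracket u y" for u x y
    using fold_add[of u "x - y" y] by simp
  have rep_diff: "representation B (x - y) b = representation B x b - representation B y b" for x y
    by (simp add: representation_diff[OF B(1)] B(2))
  have "bracket (bracket x y) z = bracket x (bracket y z) - bracket y (bracket x z)" for x y z
    using bracket_derivation[of x y z] by simp
  then show ?thesis
    unfolding lie_functional_def coefficient_functional_def
    by (simp add: B bracket_add_left bracket_scale_left fold_add fold_scale fold_diff rep_diff
        representation_add[OF B(1)] representation_scale[OF B(1)])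
qed

text \<open>
  If the centre is trivial, then an element \<open>x\<close> for which all coordinates of all \<open>[x, w]\<close> vanish is \<open>0\<close>.
  Hence every coordinate function on \<open>\<gg>\<close> is a combination of the functions sending \<open>x\<close> to a coordinate
  of \<open>[x, w]\<close>, and each of these extends to \<open>U(\<gg>)\<close> as a matrix coefficient of the adjoint representation.
\<close>

lemma coordinate_lie_functional:
  assumes B: "finite B" "independent B" "span B = UNIV"
    and centre: "\<And>x. (\<And>y. bracket x y = 0) \<Longrightarrow> x = 0" and "g \<in> B"
  shows "\<exists>l. lie_functional l \<and> l [] = 0 \<and> (\<forall>x\<in>B. l [x] = (if x = g then 1 else 0))"
proof -
  have rep_add: "representation B (x + y) b = representation B x b + representation B y b" for x y b
    by (simp add: representation_add[OF B(2)] B(3))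
  have rep_scale: "representation B (scale a x) b = a * representation B x b" for a x b
    by (simp add: representation_scale[OF B(2)] B(3))
  have rep_lin: "Vector_Spaces.linear scale (*) (\<lambda>x. representation B x b)" for b
    using linear_representation[OF B(2,3)] .
  define \<phi> where "\<phi> = (\<lambda>(b, w) x. representation B (bracket x w) b)"
  have lin: "Vector_Spaces.linear scale (*) (\<phi> i)" for i
  proof -
    obtain b w where i: "i = (b, w)" by fastforce
    show ?thesis
      by (unfold_locales)
        (simp_all add: \<phi>_def i bracket_add_left bracket_scale_left rep_add rep_scale distrib_left distrib_right)
  qed
  have "\<exists>c. \<forall>x. representation B x g = (\<Sum>i\<in>B\<times>B. c i * \<phi> i x)"
  proof (rule functional_in_span)
    fix x assume x: "\<And>i. i \<in> B \<times> B \<Longrightarrow> \<phi> i x = 0"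
    have on_basis: "bracket x w = 0" if "w \<in> B" for w
    proof -
      have "representation B (bracket x w) b = 0" for b
      proof (cases "b \<in> B")
        case True
        then show ?thesis using x[of "(b, w)"] that by (simp add: \<phi>_def)
      next
        case False
        then show ?thesis using representation_ne_zero by blast
      qed
      then show ?thesis
        using sum_nonzero_representation_eq[OF B(2), of "bracket x w"] B(3) by simp
    qed
    have "bracket x y = 0" for y
    proof (rule span_induct[of y B])
      show "y \<in> span B" using B(3) by simp
      show "subspace {y. bracket x y = 0}"
        by (simp add: subspace_def bracket_add_right bracket_scale_right bracket_zero_right)
    qed (rule on_basis)
    then have "x = 0" by (rule centre)
    then show "representation B x g = 0" by (simp add: representation_zero)
  qed (use B lin rep_lin in auto)
  then obtain c where c: "\<And>x. representation B x g = (\<Sum>i\<in>B\<times>B. c i * \<phi> i x)" by blast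
  define l where "l X = (\<Sum>i\<in>B\<times>B. c i * coefficient_functional B (fst i) (snd i) X)" for X
  have "lie_functional l"
    unfolding l_def[abs_def] by (intro lie_functional_linear_combination lie_functional_coefficient B)
  moreover have "l [] = 0" by (simp add: l_def coefficient_functional_def)
  moreover have "l [x] = (if x = g then 1 else 0)" if "x \<in> B" for x
  proof -
    have "l [x] = representation B x g"
      by (simp add: l_def c \<phi>_def coefficient_functional_def split_def)
    then show ?thesis using representation_basis[OF B(2) that] by auto
  qed
  ultimately show ?thesis by blast
qed

end

section \<open>Weights\<close>

locale simple_root_basis = ordered_generators scale bracket H \<pi> h e ordG ordA
  for scale :: "complex \<Rightarrow> 'g::ab_group_add \<Rightarrow> 'g"
    and bracket :: "'g \<Rightarrow> 'g \<Rightarrow> 'g"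
    and H :: "'g set"
    and \<pi> :: "('g \<Rightarrow> complex) set"
    and h :: "('g \<Rightarrow> complex) \<Rightarrow> 'g"
    and e :: "('g \<Rightarrow> complex) \<Rightarrow> 'g"
    and ordG :: "('g \<times> 'g) set"
    and ordA :: "('g gen \<times> 'g gen) set" +
  assumes finite_dimensional: finite_dimensional
    and simple: simple
    and cartan: "cartan_subalgebra H"
begin

definition G :: "'g set"
  where "G = G0 \<union> e ` roots H"

lemma G_eq: "G = h ` \<pi> \<union> e ` roots H"
  by (simp add: G_def G0_def)

lemma G_basis: "independent G" "span G = UNIV"
  using G_indep G_span by (simp_all add: G_eq)

lemma finite_G: "finite G"
  using finite_dimensional independent_span_bound[OF _ G_basis(1)]
  unfolding finite_dimensional_def by blast

lemma subspace_H: "subspace H"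
  using h_span subspace_span by blast

lemma G0_subset_H: "G0 \<subseteq> H"
  using h_span span_superset[of "h ` \<pi>"] by (simp add: G0_def)

lemma bracket_H: "s \<in> H \<Longrightarrow> t \<in> H \<Longrightarrow> bracket s t \<in> H"
  using cartan unfolding cartan_subalgebra_def lie_subalgebra_def by blast

lemma root_linear:
  assumes "\<alpha> \<in> roots H"
  shows "s \<in> H \<Longrightarrow> t \<in> H \<Longrightarrow> \<alpha> (s + t) = \<alpha> s + \<alpha> t" "t \<in> H \<Longrightarrow> \<alpha> (scale a t) = a * \<alpha> t" "t \<notin> H \<Longrightarrow> \<alpha> t = 0"
  using assms unfolding roots_def dual_def by blast+

lemma e_eigenvector: "\<alpha> \<in> roots H \<Longrightarrow> t \<in> H \<Longrightarrow> bracket t (e \<alpha>) = scale (\<alpha> t) (e \<alpha>)"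
  using e_root[of \<alpha>] by (simp add: root_space_def)

lemma e_nonzero: "\<alpha> \<in> roots H \<Longrightarrow> e \<alpha> \<noteq> 0"
  using e_root[of \<alpha>] by simp

lemma proper_ideal_trivial:
  assumes "lie_ideal N" "x \<notin> N" "y \<in> N"
  shows "y = 0"
  using simple assms unfolding simple_def by blast

lemma centre_trivial:
  assumes "\<And>y. bracket x y = 0"
  shows "x = 0"
proof -
  let ?N = "{x. \<forall>y. bracket x y = 0}"
  have "lie_ideal ?N"
    unfolding lie_ideal_def
  proof (intro conjI allI ballI)
    show "subspace ?N"
      by (simp add: subspace_def bracket_zero_left bracket_add_left bracket_scale_left)
    fix x y assume "y \<in> ?N"
    then have "bracket x y = 0" using bracket_anticommute[of x y] by simp
    then show "bracket x y \<in> ?N" by (simp add: bracket_zero_left)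
  qed
  moreover obtain z y where "bracket z y \<noteq> 0" using simple unfolding simple_def by blast
  then have "z \<notin> ?N" by blast
  ultimately show ?thesis using proper_ideal_trivial assms by blast
qed

lemma commutator_vanishes_on_roots:
  assumes "s \<in> H" "t \<in> H" "\<alpha> \<in> roots H"
  shows "\<alpha> (bracket s t) = 0"
proof -
  have "bracket s (bracket t (e \<alpha>)) = bracket t (bracket s (e \<alpha>))"
    using assms by (simp add: e_eigenvector bracket_scale_right mult.commute)
  then have "bracket (bracket s t) (e \<alpha>) = 0"
    using bracket_derivation[of s t "e \<alpha>"] by simp
  then show ?thesis
    using assms e_eigenvector[OF assms(3) bracket_H[OF assms(1,2)]] e_nonzero by simp
qed

text \<open>
  A simple Lie algebra is its own commutator algebra, so its lower central series is constant.
\<close>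

lemma H_proper: "H \<noteq> UNIV"
proof
  assume H: "H = UNIV"
  let ?D = "span {bracket x y | x y. x \<in> UNIV \<and> y \<in> UNIV}"
  obtain z w where zw: "bracket z w \<noteq> 0" using simple unfolding simple_def by blast
  have "lie_ideal ?D"
    unfolding lie_ideal_def using subspace_span by (auto intro: span_base)
  moreover have "bracket z w \<in> ?D" by (rule span_base) blast
  ultimately have D: "?D = UNIV" using proper_ideal_trivial zw by blast
  have "lower_central UNIV n = UNIV" for n
    by (induction n) (simp_all add: D[simplified])
  moreover obtain n where "lower_central H n = {0}"
    using cartan unfolding cartan_subalgebra_def by blast
  ultimately have "bracket z w \<in> {0}" using H by auto
  then show False using zw by simp
qed

text \<open>
  Since \<open>s\<close> and \<open>t\<close> act diagonally on the root vectors, every root vanishes on \<open>[s, t]\<close>. The elements of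
  \<open>H\<close> on which all roots vanish form an ideal \<open>Z\<close> of \<open>\<gg>\<close>: they commute with the root vectors, and
  \<open>[H, Z]\<close> lies in \<open>Z\<close> by the first remark. As \<open>H\<close> is not all of \<open>\<gg>\<close>, simplicity forces \<open>Z\<close> to
  be trivial.
\<close>

lemma H_abelian:
  assumes "s \<in> H" "t \<in> H"
  shows "bracket s t = 0"
proof -
  let ?Z = "{x \<in> H. \<forall>\<alpha>\<in>roots H. \<alpha> x = 0}"
  have zero: "\<alpha> 0 = 0" if "\<alpha> \<in> roots H" for \<alpha>
    using root_linear(2)[OF that, of 0 0] subspace_H by (simp add: subspace_0)
  have sub: "subspace ?Z"
    using subspace_H zero by (auto simp: subspace_def root_linear)
  have "bracket x y \<in> ?Z" if y: "y \<in> ?Z" for x y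
  proof (rule span_induct[of x G])
    show "x \<in> span G" using G_basis by simp
    show "subspace {x. bracket x y \<in> ?Z}"
      using sub unfolding subspace_def mem_Collect_eq bracket_zero_left bracket_add_left bracket_scale_left
      by blast
    fix x assume "x \<in> G"
    then consider "x \<in> H" | \<alpha> where "\<alpha> \<in> roots H" "x = e \<alpha>"
      using G0_subset_H by (auto simp: G_def)
    then show "bracket x y \<in> ?Z"
    proof cases
      case 1
      then show ?thesis using y by (simp add: bracket_H commutator_vanishes_on_roots)
    next
      case 2
      then have "bracket y x = 0" using y by (simp add: e_eigenvector)
      then have "bracket x y = 0" by (subst bracket_anticommute) simp
      then show ?thesis using sub subspace_0 by force
    qed
  qed
  then have "lie_ideal ?Z"
    unfolding lie_ideal_def using sub by blast
  moreover obtain x where "x \<notin> ?Z" using H_proper by blast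
  moreover have "bracket s t \<in> ?Z"
    using assms by (simp add: bracket_H commutator_vanishes_on_roots)
  ultimately show ?thesis using proper_ideal_trivial by blast
qed

lemma inj_e: "inj_on e (roots H)"
proof (rule inj_onI)
  fix \<alpha> \<beta> assume *: "\<alpha> \<in> roots H" "\<beta> \<in> roots H" "e \<alpha> = e \<beta>"
  show "\<alpha> = \<beta>"
  proof
    fix t
    show "\<alpha> t = \<beta> t"
    proof (cases "t \<in> H")
      case True
      have "scale (\<alpha> t) (e \<alpha>) = scale (\<beta> t) (e \<alpha>)"
        using trans[OF sym[OF e_eigenvector[OF *(1) True]] e_eigenvector[OF *(2) True, folded *(3)]] .
      then show ?thesis using e_nonzero[OF *(1)] by (metis scale_cancel_right)
    next
      case False
      then show ?thesis using root_linear(3)[OF *(1)] root_linear(3)[OF *(2)] by simp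
    qed
  qed
qed

lemma e_notin_G0:
  assumes "\<alpha> \<in> roots H"
  shows "e \<alpha> \<notin> G0"
proof
  assume "e \<alpha> \<in> G0"
  then have H: "e \<alpha> \<in> H" using G0_subset_H by blast
  have "\<alpha> t = 0" for t
  proof (cases "t \<in> H")
    case True
    then show ?thesis
      using e_eigenvector[OF assms True] H_abelian[OF True H] e_nonzero[OF assms] by simp
  qed (simp add: root_linear(3)[OF assms])
  then show False using assms by (auto simp: roots_def)
qed

definition wt :: "'g \<Rightarrow> 'g \<Rightarrow> complex"
  where "wt x = (if x \<in> G0 then (\<lambda>_. 0) else inv_into (roots H) e x)"

lemma wt_simps: "\<alpha> \<in> roots H \<Longrightarrow> wt (e \<alpha>) = \<alpha>" "x \<in> G0 \<Longrightarrow> wt x t = 0"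
  by (simp_all add: wt_def e_notin_G0 inj_e)

lemma bracket_weight_vector:
  assumes "x \<in> G" "t \<in> H"
  shows "bracket t x = scale (wt x t) x"
  using assms G0_subset_H H_abelian by (auto simp: G_def e_eigenvector wt_simps)

text \<open>
  An element \<open>t\<close> of \<open>H\<close> acts on \<open>[x, y]\<close> by the sum of the two weights and on the basis \<open>G\<close> diagonally;
  comparing coordinates shows that only basis vectors of the right weight occur.
\<close>

lemma bracket_expansion:
  assumes "x \<in> G" "y \<in> G"
  shows "\<exists>c. bracket x y = (\<Sum>b\<in>G. scale (c b) b) \<and>
    (\<forall>b\<in>G. \<forall>t\<in>H. c b \<noteq> 0 \<longrightarrow> wt b t = wt x t + wt y t)"
proof -
  define c where "c = representation G (bracket x y)"
  have expand: "bracket x y = (\<Sum>b\<in>G. scale (c b) b)"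
  proof -
    have "bracket x y = (\<Sum>b | c b \<noteq> 0. scale (c b) b)"
      using sum_nonzero_representation_eq[OF G_basis(1), of "bracket x y"] G_basis(2) by (simp add: c_def)
    also have "\<dots> = (\<Sum>b\<in>G. scale (c b) b)"
      by (rule sum.mono_neutral_left) (auto simp: finite_G c_def dest: representation_ne_zero)
    finally show ?thesis .
  qed
  have "wt b t = wt x t + wt y t" if "b \<in> G" "t \<in> H" "c b \<noteq> 0" for b t
  proof -
    have "bracket t (bracket x y) = scale (wt x t + wt y t) (bracket x y)"
      using assms that by (simp add: bracket_derivation[of t x y] bracket_weight_vector
          bracket_scale_left bracket_scale_right scale_left_distrib add.commute)
    moreover have sum: "bracket t (\<Sum>b\<in>S. scale (c b) b) = (\<Sum>b\<in>S. scale (c b) (bracket t b))" for S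
      by (induction S rule: infinite_finite_induct)
        (simp_all add: bracket_zero_right bracket_add_right bracket_scale_right)
    have "bracket t (bracket x y) = (\<Sum>b\<in>G. scale (c b * wt b t) b)"
      unfolding expand sum using that by (intro sum.cong) (simp_all add: bracket_weight_vector)
    moreover have "scale (wt x t + wt y t) (bracket x y) = (\<Sum>b\<in>G. scale ((wt x t + wt y t) * c b) b)"
      unfolding expand by (simp add: scale_sum_right)
    ultimately have "(\<Sum>b\<in>G. scale (c b * wt b t - (wt x t + wt y t) * c b) b) = 0"
      by (simp add: scale_left_diff_distrib sum_subtractf)
    then have "c b * wt b t - (wt x t + wt y t) * c b = 0"
      using independentD[OF G_basis(1) finite_G subset_refl _ that(1), of "\<lambda>b. c b * wt b t - (wt x t + wt y t) * c b"]
      by blast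
    then have "c b * (wt b t - (wt x t + wt y t)) = 0" by (simp add: algebra_simps)
    then show ?thesis using that(3) by simp
  qed
  then show ?thesis using expand by blast
qed

section \<open>Perfect monomials\<close>

text \<open>
  Zero weight for multisets of basis vectors. Unlike for lists of roots, elements of \<open>G\<^sub>0\<close> may occur and
  the multiset may be empty, so that the weightless multisets form a monoid.
\<close>

definition weightless :: "'g multiset \<Rightarrow> bool"
  where "weightless M \<longleftrightarrow> set_mset M \<subseteq> G \<and> (\<forall>t\<in>H. (\<Sum>x\<in>#M. wt x t) = 0)"

lemma weightless_empty: "weightless {#}"
  by (simp add: weightless_def)

lemma weightless_add: "weightless M \<Longrightarrow> weightless N \<Longrightarrow> weightless (M + N)"
  by (auto simp: weightless_def)

lemma weightless_cancel: "weightless (M + N) \<Longrightarrow> weightless M \<Longrightarrow> weightless N"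
  by (auto simp: weightless_def)

lemma weightless_image_e:
  assumes "set_mset L \<subseteq> roots H"
  shows "weightless (image_mset e L) \<longleftrightarrow> L = {#} \<or> zero_weight L"
proof -
  have "(\<Sum>x\<in>#image_mset e L. wt x t) = (\<Sum>\<alpha>\<in>#L. \<alpha> t)" for t
    unfolding image_mset.compositionality comp_def
    using assms by (intro arg_cong[of _ _ sum_mset] image_mset_cong) (auto simp: wt_simps)
  then show ?thesis
    using assms by (auto simp: weightless_def zero_weight_def G_def)
qed

lemma perfect_letter:
  assumes "p \<in> I"
  obtains as where "p = map e as" "indecomposable (mset as)" "set as \<subseteq> roots H"
    "sorted_wrt (\<lambda>\<alpha> \<beta>. (e \<alpha>, e \<beta>) \<in> ordG) as"
  using assms unfolding I_def perfect_monomials_def indecomposable_def zero_weight_def by auto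

lemma root_letters:
  assumes "p \<in> I"
  shows "set p \<subseteq> e ` roots H" "set p \<inter> G0 = {}"
proof -
  obtain as where "p = map e as" "set as \<subseteq> roots H"
    using assms by (rule perfect_letter)
  then show "set p \<subseteq> e ` roots H" "set p \<inter> G0 = {}" using e_notin_G0 by auto
qed

lemma weightless_letter:
  assumes "a \<in> alphabet"
  shows "weightless (mset (gen_word a))" "gen_word a \<noteq> []"
proof -
  consider p where "a = Csym p" "p \<in> I" | t where "a = Hsym t" "t \<in> G0"
    using assms by (auto simp: alphabet_def J_def)
  then have "weightless (mset (gen_word a)) \<and> gen_word a \<noteq> []"
  proof cases
    case 1
    obtain as where as: "p = map e as" "indecomposable (mset as)" "set as \<subseteq> roots H"
      using 1(2) by (rule perfect_letter)
    have "weightless (image_mset e (mset as))"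
      using as by (subst weightless_image_e) (auto simp: indecomposable_def)
    then show ?thesis using 1 as by (auto simp: I_def)
  next
    case 2
    then show ?thesis by (auto simp: weightless_def wt_simps G_def)
  qed
  then show "weightless (mset (gen_word a))" "gen_word a \<noteq> []" by auto
qed

lemma zero_weight_contains_indecomposable:
  assumes "zero_weight L"
  shows "\<exists>L1. indecomposable L1 \<and> L1 \<subseteq># L"
  using assms
proof (induction L rule: measure_induct_rule[of size])
  case (less L)
  show ?case
  proof (cases "indecomposable L")
    case False
    then obtain L1 L2 where L: "L = L1 + L2" "zero_weight L1" "zero_weight L2"
      using less.prems by (auto simp: indecomposable_def)
    then have "size L1 < size L" by (simp add: zero_weight_def nonempty_has_size)
    then obtain L' where "indecomposable L'" "L' \<subseteq># L1" using less.IH L(2) by blast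
    then show ?thesis using L(1) by (meson mset_subset_eq_add_left subset_mset.order_trans)
  qed auto
qed

text \<open>
  Sorting gives the monomial; it has more than one factor because a single root is not zero.
\<close>

lemma exists_perfect_word:
  assumes "indecomposable L"
  shows "\<exists>p\<in>I. mset p = image_mset e L"
proof -
  have L: "set_mset L \<subseteq> roots H" "zero_weight L"
    using assms by (auto simp: indecomposable_def zero_weight_def)
  have "set_mset (image_mset e L) \<subseteq> h ` \<pi> \<union> e ` roots H" using L by auto
  from exists_sorted_list[OF ordG this] obtain p where
    p: "mset p = image_mset e L" "sorted_wrt (\<lambda>x y. (x, y) \<in> ordG) p" by auto
  define as where "as = map (inv_into (roots H) e) p"
  have set_p: "set p \<subseteq> e ` roots H"
    using arg_cong[OF p(1), of set_mset] L by auto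
  have pe: "p = map e as"
    unfolding as_def map_map using set_p by (intro map_idI[symmetric]) (auto simp: f_inv_into_f)
  have "mset as = image_mset (\<lambda>\<alpha>. inv_into (roots H) e (e \<alpha>)) L"
    unfolding as_def mset_map p(1) image_mset.compositionality comp_def ..
  also have "\<dots> = image_mset (\<lambda>\<alpha>. \<alpha>) L"
    using L inj_e by (intro image_mset_cong) auto
  finally have as: "mset as = L" by simp
  have "p \<in> perfect_monomials"
    unfolding perfect_monomials_def using p(2) pe as assms by (auto simp: sorted_wrt_map)
  moreover have "length p > 1"
  proof (rule ccontr)
    assume "\<not> length p > 1"
    then have "size L \<le> 1" unfolding as[symmetric] pe by simp
    moreover have "L \<noteq> {#}" using L by (simp add: zero_weight_def)
    ultimately have "size L = 1" by (simp add: le_Suc_eq)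
    then obtain \<alpha> where \<alpha>: "L = {#\<alpha>#}" using size_1_singleton_mset by blast
    then have "\<alpha> \<in> roots H" "\<forall>t\<in>H. \<alpha> t = 0" using L by (auto simp: zero_weight_def)
    then have "\<alpha> = (\<lambda>_. 0)" using root_linear(3) by blast
    then show False using \<open>\<alpha> \<in> roots H\<close> by (simp add: roots_def)
  qed
  ultimately show ?thesis using p(1) unfolding I_def by blast
qed

lemma exists_letter:
  assumes M: "weightless M" "M \<noteq> {#}"
  shows "\<exists>a\<in>alphabet. mset (gen_word a) \<subseteq># M"
proof (cases "set_mset M \<inter> G0 = {}")
  case True
  then have sub: "set_mset M \<subseteq> e ` roots H" using M by (auto simp: weightless_def G_def)
  define L where "L = image_mset (inv_into (roots H) e) M"
  have "image_mset e L = image_mset (\<lambda>x. x) M"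
    unfolding L_def image_mset.compositionality comp_def
    using sub by (intro image_mset_cong) (auto simp: f_inv_into_f)
  then have L: "image_mset e L = M" by simp
  have roots: "set_mset L \<subseteq> roots H" unfolding L_def using sub by (auto intro: inv_into_into)
  have "zero_weight L" using weightless_image_e[OF roots] M L by auto
  then obtain L1 where L1: "indecomposable L1" "L1 \<subseteq># L"
    using zero_weight_contains_indecomposable by blast
  obtain p where p: "p \<in> I" "mset p = image_mset e L1" using exists_perfect_word[OF L1(1)] by blast
  then have "mset p \<subseteq># M" using image_mset_subseteq_mono[OF L1(2), of e] L by simp
  then show ?thesis using p(1) by (intro bexI[of _ "Csym p"]) (simp_all add: alphabet_def J_def)
next
  case False
  then obtain t where "t \<in># M" "t \<in> G0" by auto
  then show ?thesis by (intro bexI[of _ "Hsym t"]) (simp_all add: alphabet_def)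
qed

lemma finite_roots: "finite (roots H)"
  using finite_G inj_e by (auto simp: G_def dest: finite_imageD)

text \<open>
  The indecomposable lists form an antichain: if one is contained in another, the complement has zero
  weight as well, so it must be empty.
\<close>

lemma finite_I: "finite I"
proof -
  have "finite (Collect indecomposable)"
  proof (rule finite_antichain_multisets[OF finite_roots])
    fix L assume "L \<in> Collect indecomposable"
    then show "set_mset L \<subseteq> roots H" by (simp add: indecomposable_def zero_weight_def)
  next
    fix L N assume LN: "L \<in> Collect indecomposable" "N \<in> Collect indecomposable" "L \<subseteq># N"
    then obtain N' where N': "N = L + N'" by (auto simp: mset_subset_eq_exists_conv)
    show "L = N"
    proof (rule ccontr)
      assume "L \<noteq> N"
      moreover have "indecomposable N" using LN(2) by simp
      moreover have L: "zero_weight L" and N: "zero_weight N"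
        using LN(1,2) unfolding mem_Collect_eq indecomposable_def by blast+
      ultimately have "zero_weight N'"
        unfolding zero_weight_def N' by simp
      then show False using L \<open>indecomposable N\<close> N' unfolding indecomposable_def by blast
    qed
  qed
  moreover have "I \<subseteq> (\<lambda>as. map e as) ` (\<Union>L\<in>Collect indecomposable. {as. mset as = L})"
  proof
    fix p assume "p \<in> I"
    then obtain as where "p = map e as" "indecomposable (mset as)" by (rule perfect_letter)
    then show "p \<in> (\<lambda>as. map e as) ` (\<Union>L\<in>Collect indecomposable. {as. mset as = L})" by blast
  qed
  moreover have "finite {as. mset as = L}" for L :: "('g \<Rightarrow> complex) multiset"
  proof -
    obtain xs where "mset xs = L" using ex_mset by blast
    then show ?thesis
      by (intro finite_subset[OF _ finite_lists_length_eq[of "set_mset L" "size L"]])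
        (auto dest: mset_eq_setD mset_eq_length)
  qed
  ultimately show ?thesis by (meson finite_UN_I finite_imageI finite_subset)
qed

lemma length_le_d0: "p \<in> I \<Longrightarrow> length p \<le> d0"
  unfolding d0_def using finite_I by simp

lemma finite_alphabet: "finite alphabet"
  using finite_I finite_G by (simp add: alphabet_def J_def G_def)

section \<open>Semi-perfect words\<close>

lemma omega_simps [simp]:
  "omega [] = []" "omega (a # Y) = gen_word a @ omega Y" "omega (Y @ Z) = omega Y @ omega Z"
  by (simp_all add: omega_def)

lemma weightless_omega: "Y \<in> Q0 \<Longrightarrow> weightless (mset (omega Y))"
  unfolding Q0_def
  by (induction Y) (auto simp: weightless_empty weightless_letter intro!: weightless_add)

lemma mem_T1: "X \<in> T1 Y \<longleftrightarrow> X \<in> Q0 \<and> mset (omega X) = mset (omega Y)"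
  unfolding T1_def T0_def by (auto simp: set_eq_iff)

lemma lex_less_Cons_same:
  assumes "lex_less r X Y"
  shows "lex_less r (x # X) (x # Y)"
proof -
  obtain s where s: "s < min (length X) (length Y)" "\<And>t. t < s \<Longrightarrow> X ! t = Y ! t"
    "X ! s \<noteq> Y ! s" "(X ! s, Y ! s) \<in> r"
    using assms unfolding lex_less_def by blast
  then show ?thesis
    unfolding lex_less_def by (intro exI[of _ "Suc s"]) (auto simp: nth_Cons split: nat.split)
qed

lemma lex_less_asym:
  assumes "lex_less ordA X Y" "lex_less ordA Y X"
  shows False
proof -
  obtain s where s: "\<And>t. t < s \<Longrightarrow> X ! t = Y ! t" "X ! s \<noteq> Y ! s" "(X ! s, Y ! s) \<in> ordA"
    using assms(1) unfolding lex_less_def by blast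
  obtain s' where s': "\<And>t. t < s' \<Longrightarrow> Y ! t = X ! t" "Y ! s' \<noteq> X ! s'" "(Y ! s', X ! s') \<in> ordA"
    using assms(2) unfolding lex_less_def by blast
  have "s = s'" using s(1)[of s'] s'(1)[of s] s(2) s'(2) by (metis linorder_neqE_nat)
  then show False using s s' linear_order_on_rules(3)[OF ordA, of "X ! s" "Y ! s"] by simp
qed

text \<open>
  Two different minimal words of the same class would precede each other.
\<close>

lemma semi_perfect_unique:
  assumes "semi_perfect X" "semi_perfect Y" "mset (omega X) = mset (omega Y)"
  shows "X = Y"
proof (rule ccontr)
  assume "X \<noteq> Y"
  have "lex_less ordA X Y" "lex_less ordA Y X"
    using assms \<open>X \<noteq> Y\<close> by (auto simp: semi_perfect_def mem_T1)
  then show False by (rule lex_less_asym)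
qed

text \<open>
  For weightless \<open>M\<close> these are the possible first letters of the words of its class, since what
  remains after removing a letter from a weightless multiset is weightless again.
\<close>

definition dividing_letters :: "'g multiset \<Rightarrow> 'g gen set"
  where "dividing_letters M = {a \<in> alphabet. mset (gen_word a) \<subseteq># M}"

definition least_dividing_letter :: "'g multiset \<Rightarrow> 'g gen \<Rightarrow> bool"
  where "least_dividing_letter M c \<longleftrightarrow> c \<in> dividing_letters M \<and> (\<forall>a\<in>dividing_letters M. (c, a) \<in> ordA)"

lemma exists_least_dividing_letter:
  assumes "weightless M" "M \<noteq> {#}"
  shows "\<exists>c. least_dividing_letter M c"
proof -
  have "dividing_letters M \<subseteq> alphabet" by (auto simp: dividing_letters_def)
  moreover have "dividing_letters M \<noteq> {}"
    using exists_letter[OF assms] by (auto simp: dividing_letters_def)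
  ultimately have "\<exists>c\<in>dividing_letters M. \<forall>a\<in>dividing_letters M. (c, a) \<in> ordA"
    using exists_least[OF ordA, of "dividing_letters M"] finite_subset[OF _ finite_alphabet] by blast
  then show ?thesis by (auto simp: least_dividing_letter_def)
qed

lemma semi_perfect_Nil: "semi_perfect []"
proof -
  have "X = []" if "X \<in> Q0" "omega X = []" for X
    using that weightless_letter(2) by (cases X) (auto simp: Q0_def)
  then show ?thesis by (auto simp: semi_perfect_def mem_T1 Q0_def)
qed

text \<open>
  A competitor begins with a dividing letter. Either this letter comes after \<open>c\<close>, or it equals \<open>c\<close> and
  the comparison is decided by the remaining word.
\<close>

lemma semi_perfect_Cons:
  assumes Z: "semi_perfect Z" and c: "least_dividing_letter (mset (gen_word c) + mset (omega Z)) c"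
  shows "semi_perfect (c # Z)"
  unfolding semi_perfect_def
proof (intro conjI ballI impI)
  have "c \<in> alphabet" using c by (simp add: least_dividing_letter_def dividing_letters_def)
  then show "c # Z \<in> Q0" using Z by (simp add: semi_perfect_def Q0_def)
  fix X assume X: "X \<in> T1 (c # Z)" "X \<noteq> c # Z"
  then have "X \<noteq> []"
    using weightless_letter(2)[OF \<open>c \<in> alphabet\<close>] by (auto simp: mem_T1)
  then obtain a X' where X': "X = a # X'" by (cases X) auto
  show "lex_less ordA (c # Z) X"
  proof (cases "a = c")
    case True
    then have "X' \<in> T1 Z" "X' \<noteq> Z" using X X' by (auto simp: mem_T1 Q0_def)
    then have "lex_less ordA Z X'" using Z by (simp add: semi_perfect_def)
    then show ?thesis using True X' by (simp add: lex_less_Cons_same)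
  next
    case False
    have "mset (gen_word a) + mset (omega X') = mset (gen_word c) + mset (omega Z)" "a \<in> alphabet"
      using X X' by (auto simp: mem_T1 Q0_def)
    then have "a \<in> dividing_letters (mset (gen_word c) + mset (omega Z))"
      unfolding dividing_letters_def by (metis (mono_tags) mem_Collect_eq mset_subset_eq_add_left)
    then have "(c, a) \<in> ordA" using c by (simp add: least_dividing_letter_def)
    then show ?thesis using False X' unfolding lex_less_def by (intro exI[of _ 0]) simp
  qed
qed

lemma exists_semi_perfect:
  assumes "weightless M"
  shows "\<exists>Y. semi_perfect Y \<and> mset (omega Y) = M"
  using assms
proof (induction M rule: measure_induct_rule[of size])
  case (less M)
  show ?case
  proof (cases "M = {#}")
    case True
    then show ?thesis using semi_perfect_Nil by (intro exI[of _ "[]"]) simp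
  next
    case False
    then obtain c where c: "least_dividing_letter M c"
      using exists_least_dividing_letter less.prems by blast
    then have ca: "c \<in> alphabet" and "mset (gen_word c) \<subseteq># M"
      by (auto simp: least_dividing_letter_def dividing_letters_def)
    then obtain N where N: "M = mset (gen_word c) + N"
      by (auto simp: mset_subset_eq_exists_conv)
    have "weightless N" using weightless_cancel less.prems weightless_letter(1)[OF ca] N by blast
    moreover have "size N < size M" using N weightless_letter(2)[OF ca] by simp
    ultimately obtain Z where Z: "semi_perfect Z" "mset (omega Z) = N" using less.IH by blast
    then have "semi_perfect (c # Z)" using semi_perfect_Cons c N by blast
    then show ?thesis using Z N by (intro exI[of _ "c # Z"]) simp
  qed
qed

definition semi_perfect_word :: "'g multiset \<Rightarrow> 'g gen list"
  where "semi_perfect_word M = (THE Y. semi_perfect Y \<and> mset (omega Y) = M)"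

lemma semi_perfect_word:
  assumes "weightless M"
  shows "semi_perfect (semi_perfect_word M)" "mset (omega (semi_perfect_word M)) = M"
proof -
  have "\<exists>!Y. semi_perfect Y \<and> mset (omega Y) = M"
    using exists_semi_perfect[OF assms] semi_perfect_unique by blast
  from theI'[OF this] show "semi_perfect (semi_perfect_word M)" "mset (omega (semi_perfect_word M)) = M"
    unfolding semi_perfect_word_def by auto
qed

lemma semi_perfect_word_eq: "semi_perfect Y \<Longrightarrow> semi_perfect_word (mset (omega Y)) = Y"
  using semi_perfect_unique semi_perfect_word weightless_omega semi_perfect_def by metis

text \<open>
  The lexicographic minimum is found greedily.
\<close>

lemma semi_perfect_word_greedy:
  assumes M: "weightless (mset (gen_word c) + N)" and c: "least_dividing_letter (mset (gen_word c) + N) c"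
  shows "semi_perfect_word (mset (gen_word c) + N) = c # semi_perfect_word N" "weightless N"
proof -
  have ca: "c \<in> alphabet" using c by (simp add: least_dividing_letter_def dividing_letters_def)
  show N: "weightless N" using weightless_cancel M weightless_letter(1)[OF ca] by blast
  have "semi_perfect (c # semi_perfect_word N)"
    using semi_perfect_Cons semi_perfect_word[OF N] c by simp
  from semi_perfect_word_eq[OF this]
  show "semi_perfect_word (mset (gen_word c) + N) = c # semi_perfect_word N"
    using semi_perfect_word[OF N] by simp
qed

text \<open>
  For each element of \<open>P\<close> one letter of \<open>X\<close> containing it is enough. Applied to \<open>P = p\<^sub>c\<close> this is where the
  bound \<open>d\<^sub>0\<close> on the number of factors comes from.
\<close>

lemma covering_letters:
  assumes "P \<subseteq># mset (omega X)"
  shows "\<exists>S R. mset X = mset S + mset R \<and> length S \<le> size P \<and> P \<subseteq># mset (omega S) \<and>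
    (\<forall>a\<in>set S. set (gen_word a) \<inter> set_mset P \<noteq> {})"
  using assms
proof (induction X arbitrary: P)
  case Nil
  then show ?case by (intro exI[of _ "[]"]) simp
next
  case (Cons a X)
  define P1 where "P1 = P - mset (gen_word a)"
  have "P1 \<subseteq># mset (omega X)"
    using Cons.prems by (simp add: P1_def subset_eq_diff_conv add.commute)
  from Cons.IH[OF this] obtain S R where SR: "mset X = mset S + mset R" "length S \<le> size P1"
    "P1 \<subseteq># mset (omega S)" "\<And>b. b \<in> set S \<Longrightarrow> set (gen_word b) \<inter> set_mset P1 \<noteq> {}" by blast
  have P1: "set_mset P1 \<subseteq> set_mset P" unfolding P1_def by (auto dest: in_diffD)
  show ?case
  proof (cases "set (gen_word a) \<inter> set_mset P = {}")
    case True
    have "count P1 x = count P x" for x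
    proof (cases "x \<in> set (gen_word a)")
      case True
      then have "count P x = 0"
        using \<open>set (gen_word a) \<inter> set_mset P = {}\<close> by (simp add: count_eq_zero_iff disjoint_iff)
      then show ?thesis by (simp add: P1_def)
    qed (simp add: P1_def not_in_iff[symmetric] count_eq_zero_iff[THEN iffD2])
    then have "P1 = P" by (rule multiset_eqI)
    then show ?thesis
      using SR by (intro exI[of _ S] exI[of _ "a # R"] conjI ballI) simp_all
  next
    case False
    then obtain x where x: "x \<in> set (gen_word a)" "x \<in># P" by blast
    have "size P1 < size P"
    proof (rule mset_subset_size)
      have "count P1 x < count P x" using x by (simp add: P1_def)
      moreover have "P1 \<subseteq># P" by (simp add: P1_def)
      ultimately show "P1 \<subset># P" by (metis less_irrefl subset_mset.le_neq_trans)
    qed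
    moreover have "P \<subseteq># mset (omega (a # S))"
      using SR(3) by (simp add: P1_def subset_eq_diff_conv add.commute)
    moreover have "set (gen_word b) \<inter> set_mset P \<noteq> {}" if "b \<in> set (a # S)" for b
      using that False SR(4)[of b] P1 by auto
    ultimately show ?thesis
      using SR(1,2) by (intro exI[of _ "a # S"] exI[of _ R] conjI ballI) simp_all
  qed
qed

section \<open>The free algebra and its evaluation\<close>

lemma F_scalar_simps:
  "F_scalar (a + b) = F_scalar a + F_scalar b" "F_scalar (a * b) = F_scalar a * F_scalar b"
  "F_scalar 1 = 1" "F_scalar 0 = 0"
  by (simp_all add: F_scalar_def single_add mult_single)

lemma F_scalar_left_commute: "f * (F_scalar a * g) = F_scalar a * (f * g)"
  unfolding F_scalar_def by (rule scalar_left_commute)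

sublocale fv: vector_space "\<lambda>a f. F_scalar a * f"
  by unfold_locales (simp_all add: F_scalar_simps distrib_left distrib_right mult.assoc)

lemma F_ring: "ring F"
  unfolding F_def by (rule free_algebra_ring) (rule polynomials_closed; assumption)+

lemma F_closed:
  "0 \<in> carrier F" "1 \<in> carrier F" "f \<in> carrier F \<Longrightarrow> g \<in> carrier F \<Longrightarrow> f + g \<in> carrier F"
  "f \<in> carrier F \<Longrightarrow> g \<in> carrier F \<Longrightarrow> f * g \<in> carrier F" "f \<in> carrier F \<Longrightarrow> - f \<in> carrier F"
  unfolding F_def by (rule free_algebra_closed; (rule polynomials_closed)?; assumption?)+

lemma F_diff_closed: "f \<in> carrier F \<Longrightarrow> g \<in> carrier F \<Longrightarrow> f - g \<in> carrier F"
  using F_closed(3)[of f "- g"] F_closed(5)[of g] by simp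

lemma F_simps:
  "monoid.mult F = (*)" "one F = 1" "ring.zero F = 0" "add F = (+)"
  by (simp_all add: F_def free_algebra_simps)

lemma mem_F: "f \<in> carrier F \<longleftrightarrow> (\<forall>w\<in>Poly_Mapping.keys f. set (letters w) \<subseteq> J) \<and>
    (\<forall>w. Poly_Mapping.lookup f w \<in> polynomials G0)"
  unfolding F_def by (rule mem_free_algebra) (rule polynomials_closed)

lemma F_scalar_closed: "F_scalar a \<in> carrier F"
  by (auto simp: mem_F F_scalar_def zero_word_def lookup_single when_def polynomials_def)

lemma F_gen_closed:
  assumes "a \<in> alphabet"
  shows "F_gen a \<in> carrier F"
proof -
  consider p where "a = Csym p" "a \<in> J" | t where "a = Hsym t" "t \<in> G0"
    using assms by (auto simp: alphabet_def J_def)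
  then show ?thesis
    by cases (auto simp: mem_F lookup_single when_def polynomials_def zero_word_def)
qed

lemma F_word_simps: "F_word [] = 1" "F_word (a # Y) = F_gen a * F_word Y" "F_word (Y @ Z) = F_word Y * F_word Z"
  by (simp_all add: F_word_def)

lemma F_word_closed: "Y \<in> Q0 \<Longrightarrow> F_word Y \<in> carrier F"
  unfolding Q0_def by (induction Y) (auto simp: F_word_simps F_closed F_gen_closed)

lemma F_gen_Hsym_central: "F_gen (Hsym t) * f = f * F_gen (Hsym t)"
  unfolding F_gen.simps by (rule scalar_central)

primrec csyms :: "'g gen list \<Rightarrow> 'g gen list"
  where "csyms [] = []"
  | "csyms (a # Y) = (case a of Csym p \<Rightarrow> Csym p # csyms Y | Hsym t \<Rightarrow> csyms Y)"

primrec hsyms :: "'g gen list \<Rightarrow> 'g list"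
  where "hsyms [] = []"
  | "hsyms (a # Y) = (case a of Csym p \<Rightarrow> hsyms Y | Hsym t \<Rightarrow> t # hsyms Y)"

definition exponents :: "'g list \<Rightarrow> 'g \<Rightarrow>\<^sub>0 nat"
  where "exponents ts = sum_list (map (\<lambda>t. Poly_Mapping.single t 1) ts)"

lemma exponents_simps:
  "exponents [] = 0" "exponents (t # ts) = Poly_Mapping.single t 1 + exponents ts"
  "exponents (ts @ us) = exponents ts + exponents us"
  by (simp_all add: exponents_def)

lemma lookup_exponents: "Poly_Mapping.lookup (exponents ts) t = count (mset ts) t"
  by (induction ts) (simp_all add: exponents_simps lookup_add lookup_single when_def)

lemma exponents_eq_iff: "exponents ts = exponents us \<longleftrightarrow> mset ts = mset us"
  by (simp add: poly_mapping_eq_iff multiset_eq_iff fun_eq_iff lookup_exponents)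

lemma exponents_surj: "\<exists>ts. exponents ts = m"
proof (induction m rule: poly_mapping_singles_induct)
  case zero
  show ?case by (rule exI[of _ "[]"]) (simp add: exponents_simps)
next
  case (single k)
  have "exponents (replicate n k) = Poly_Mapping.single k n" for n
    by (rule poly_mapping_eqI) (simp add: lookup_exponents lookup_single when_def)
  then show ?case by blast
next
  case (add f g)
  then show ?case using exponents_simps(3) by metis
qed

text \<open>
  In \<open>F\<close> only the order of the symbols \<open>c\<^sub>i\<close> matters; the elements of \<open>G\<^sub>0\<close> are collected in the coefficient.
\<close>

lemma F_word_eq_single:
  "F_word Y = Poly_Mapping.single (Word (csyms Y)) (Poly_Mapping.single (exponents (hsyms Y)) 1)"
proof (induction Y)
  case Nil
  show ?case by (simp add: F_word_simps exponents_simps flip: zero_word_def)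
next
  case (Cons a Y)
  then show ?case
    by (cases a) (simp_all add: F_word_simps mult_single plus_word_def exponents_simps zero_word_def)
qed

lemma carrier_F_subset_span: "carrier F \<subseteq> fv.span (F_word ` Q0)"
proof
  fix f assume f: "f \<in> carrier F"
  show "f \<in> fv.span (F_word ` Q0)"
  proof (induction f rule: poly_mapping_singles_induct)
    case (single w)
    have w: "set (letters w) \<subseteq> J"
      and p: "m \<in> Poly_Mapping.keys (Poly_Mapping.lookup f w) \<Longrightarrow> Poly_Mapping.keys m \<subseteq> G0" for m
      using f single by (auto simp: mem_F polynomials_def)
    have "Poly_Mapping.single w p \<in> fv.span (F_word ` Q0)"
      if p: "\<And>m. m \<in> Poly_Mapping.keys p \<Longrightarrow> Poly_Mapping.keys m \<subseteq> G0" for p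
    proof (induction p rule: poly_mapping_singles_induct)
      case (single m)
      obtain ts where ts: "exponents ts = m" using exponents_surj by blast
      have "set ts \<subseteq> Poly_Mapping.keys m"
      proof
        fix t assume "t \<in> set ts"
        then have "Poly_Mapping.lookup (exponents ts) t \<noteq> 0"
          by (simp add: lookup_exponents count_eq_zero_iff)
        then show "t \<in> Poly_Mapping.keys m" by (simp add: ts in_keys_iff)
      qed
      also have "Poly_Mapping.keys m \<subseteq> G0" using p[OF single] .
      finally have ts_G0: "set ts \<subseteq> G0" .
      let ?Y = "map Hsym ts @ letters w"
      have "csyms (map Hsym ts @ V) = csyms V" "hsyms (map Hsym ts @ V) = ts @ hsyms V" for V
        by (induction ts) simp_all
      moreover have "csyms V = V \<and> hsyms V = []" if "set V \<subseteq> J" for V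
        using that by (induction V) (auto simp: J_def)
      ultimately have "F_word ?Y = Poly_Mapping.single w (Poly_Mapping.single m 1)"
        using w ts by (simp add: F_word_eq_single)
      then have "Poly_Mapping.single w (Poly_Mapping.single m (Poly_Mapping.lookup p m))
          = F_scalar (Poly_Mapping.lookup p m) * F_word ?Y"
        by (simp add: F_scalar_def mult_single)
      moreover have "?Y \<in> Q0"
        using w image_mono[OF ts_G0, of Hsym] unfolding Q0_def alphabet_def lists_eq_set by simp blast
      ultimately show ?case by (auto intro: fv.span_scale fv.span_base)
    qed (auto simp: single_add intro: fv.span_add fv.span_zero)
    then show ?case using p by blast
  qed (auto intro: fv.span_add fv.span_zero)
qed

text \<open>
  A commutative monomial in \<open>G\<^sub>0\<close> is written as a word in an arbitrary order. The choice disappears in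
  \<open>U(\<gg>)\<close>, where the elements of \<open>G\<^sub>0\<close> commute.
\<close>

definition hword :: "('g \<Rightarrow>\<^sub>0 nat) \<Rightarrow> 'g list"
  where "hword m = (SOME ts. exponents ts = m)"

lemma mset_hword: "mset (hword (exponents ts)) = mset ts"
  unfolding hword_def exponents_eq_iff by (rule someI) (rule refl)

text \<open>
  The evaluation \<open>F \<rightarrow> U\<^sub>0(\<gg>)\<close> before passing to the quotient. This map is linear, which makes it convenient,
  but it is multiplicative only modulo the relations, because the elements of \<open>G\<^sub>0\<close> are central in \<open>F\<close> and
  not in the free algebra on \<open>\<gg>\<close>.
\<close>

definition lift :: "('g gen word \<Rightarrow>\<^sub>0 (('g \<Rightarrow>\<^sub>0 nat) \<Rightarrow>\<^sub>0 complex)) \<Rightarrow> ('g word \<Rightarrow>\<^sub>0 complex)"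
  where "lift = additive_extension (\<lambda>w. additive_extension (\<lambda>m a.
    scalar a * monomial (hword m @ omega (letters w))))"

lemma lift_add: "lift (f + g) = lift f + lift g"
  unfolding lift_def
  by (intro additive_extension_add) (simp_all add: single_add distrib_right)

lemma lift_zero: "lift 0 = 0"
  by (simp add: lift_def)

lemma lift_single: "lift (Poly_Mapping.single w (Poly_Mapping.single m a))
    = scalar a * monomial (hword m @ omega (letters w))"
  by (simp add: lift_def additive_extension_single)

lemma lift_scalar: "lift (F_scalar a * f) = scalar a * lift f"
proof (induction f rule: poly_mapping_singles_induct)
  case (single w)
  have "lift (F_scalar a * Poly_Mapping.single w p) = scalar a * lift (Poly_Mapping.single w p)" for p
  proof (induction p rule: poly_mapping_singles_induct)
    case (single m)
    show ?case by (simp add: F_scalar_def mult_single lift_single flip: mult.assoc)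
  qed (simp_all add: single_add distrib_left lift_add lift_zero)
  then show ?case .
qed (simp_all add: distrib_left lift_add lift_zero)

text \<open>
  Moving \<open>t\<close> past a letter \<open>x\<close> costs a multiple of the remaining word, with factor the weight of \<open>x\<close> at \<open>t\<close>.
\<close>

lemma commute_H_past_word:
  assumes "t \<in> H" "set X \<subseteq> G"
  shows "monomial (t # X) - monomial (X @ [t]) - scalar (\<Sum>x\<leftarrow>X. wt x t) * monomial X \<in> relations_ideal"
  using assms(2)
proof (induction X)
  case Nil
  show ?case by (simp add: relations_ideal_closed)
next
  case (Cons x X)
  let ?k = "\<Sum>x\<leftarrow>X. wt x t"
  have "monomial ([] @ t # x # X) - monomial ([] @ x # t # X) - monomial ([] @ bracket t x # X) \<in> relations_ideal"
    by (rule monomial_relations)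
  moreover have "monomial ([] @ bracket t x # X) - scalar (wt x t) * monomial ([] @ x # X) \<in> relations_ideal"
    using Cons.prems assms(1) monomial_relations(2)[of "[]"] by (simp add: bracket_weight_vector)
  moreover have "monomial [x] * (monomial (t # X) - monomial (X @ [t]) - scalar ?k * monomial X) \<in> relations_ideal"
    using Cons by (intro relations_ideal_closed(2-6)) simp_all
  then have "monomial (x # t # X) - monomial (x # X @ [t]) - scalar ?k * monomial (x # X) \<in> relations_ideal"
    by (simp add: right_diff_distrib scalar_left_commute flip: monomial_append)
  ultimately have "(monomial (t # x # X) - monomial (x # t # X) - monomial (bracket t x # X))
      + (monomial (bracket t x # X) - scalar (wt x t) * monomial (x # X))
      + (monomial (x # t # X) - monomial (x # X @ [t]) - scalar ?k * monomial (x # X)) \<in> relations_ideal"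
    by (intro relations_ideal_closed(2-6)) simp_all
  then show ?case by (simp add: single_add distrib_right algebra_simps)
qed

lemma H_commutes_with_weightless:
  assumes "t \<in> H" "weightless (mset X)"
  shows "monomial (t # X) - monomial (X @ [t]) \<in> relations_ideal"
proof -
  have "(\<Sum>x\<leftarrow>X. wt x t) = 0"
    using assms by (simp add: weightless_def flip: sum_mset_sum_list)
  then show ?thesis
    using commute_H_past_word[OF assms(1), of X] assms(2) by (simp add: weightless_def)
qed

lemma H_word_commutes_with_weightless:
  assumes "set ts \<subseteq> H" "weightless (mset X)"
  shows "monomial (ts @ X) - monomial (X @ ts) \<in> relations_ideal"
  using assms(1)
proof (induction ts)
  case (Cons t ts)
  have "monomial [t] * (monomial (ts @ X) - monomial (X @ ts)) \<in> relations_ideal"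
    using Cons by (intro relations_ideal_closed(2-6)) simp_all
  moreover have "(monomial (t # X) - monomial (X @ [t])) * monomial ts \<in> relations_ideal"
    using Cons H_commutes_with_weightless[OF _ assms(2)] by (intro relations_ideal_closed(2-6)) simp_all
  ultimately have "monomial (t # ts @ X) - monomial (t # X @ ts) \<in> relations_ideal"
    "monomial (t # X @ ts) - monomial (X @ t # ts) \<in> relations_ideal"
    by (simp_all add: left_diff_distrib right_diff_distrib flip: monomial_append)
  from relations_ideal_trans[OF this] show ?case by simp
qed (simp add: relations_ideal_closed)

lemma H_word_permute:
  assumes "set ts \<subseteq> H" "mset ts = mset us"
  shows "monomial (ts @ X) - monomial (us @ X) \<in> relations_ideal"
proof (rule adjacent_swaps_imp_permutation[where M = "mset ts" and f = "\<lambda>ts. monomial (ts @ X)"])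
  fix A x y B assume "mset (A @ [x, y] @ B) = mset ts"
  from mset_eq_setD[OF this] have "bracket x y = 0" using assms(1) by (intro H_abelian) auto
  then have "monomial (A @ x # y # B @ X) - monomial (A @ y # x # B @ X) - monomial (A @ 0 # B @ X) \<in> relations_ideal"
    using monomial_relations(3)[of A x y "B @ X"] by simp
  moreover have "monomial (A @ 0 # B @ X) \<in> relations_ideal"
    using monomial_relations(2)[of A 0 0 "B @ X"] by simp
  ultimately show "monomial ((A @ [x, y] @ B) @ X) - monomial ((A @ [y, x] @ B) @ X) \<in> relations_ideal"
    using relations_ideal_closed(3) by fastforce
qed (use assms in \<open>auto intro: relations_ideal_closed(2-6)\<close>)

lemma hsyms_in_G0: "Y \<in> Q0 \<Longrightarrow> set (hsyms Y) \<subseteq> G0"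
  unfolding Q0_def by (induction Y) (auto simp: alphabet_def J_def split: gen.split)

text \<open>
  In \<open>F_word Y\<close> the elements of \<open>G\<^sub>0\<close> are collected at the front, in \<open>omega Y\<close> they stand where \<open>Y\<close> has them.
  Modulo the relations this makes no difference, as they commute with each other and with the words
  \<open>p\<^sub>i\<close>, which are weightless.
\<close>

lemma lift_F_word:
  assumes "Y \<in> Q0"
  shows "lift (F_word Y) - monomial (omega Y) \<in> relations_ideal"
proof -
  have "monomial (hsyms Y @ omega (csyms Y)) - monomial (omega Y) \<in> relations_ideal"
    using assms
  proof (induction Y)
    case Nil
    show ?case by (simp add: relations_ideal_closed)
  next
    case (Cons a Y)
    then have Y: "Y \<in> Q0" and a: "a \<in> alphabet" by (auto simp: Q0_def)
    have "monomial (gen_word a) * (monomial (hsyms Y @ omega (csyms Y)) - monomial (omega Y)) \<in> relations_ideal"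
      using Cons.IH Y by (intro relations_ideal_closed(2-6)) simp
    then have step: "monomial (gen_word a @ hsyms Y @ omega (csyms Y)) - monomial (gen_word a @ omega Y) \<in> relations_ideal"
      by (simp add: right_diff_distrib flip: monomial_append)
    show ?case
    proof (cases a)
      case (Csym p)
      have "monomial (hsyms Y @ p) - monomial (p @ hsyms Y) \<in> relations_ideal"
        using hsyms_in_G0[OF Y] G0_subset_H weightless_letter(1)[OF a] Csym
        by (intro H_word_commutes_with_weightless) auto
      then have "(monomial (hsyms Y @ p) - monomial (p @ hsyms Y)) * monomial (omega (csyms Y)) \<in> relations_ideal"
        by (rule relations_ideal_closed(6))
      then have "monomial (hsyms Y @ p @ omega (csyms Y)) - monomial (p @ hsyms Y @ omega (csyms Y))
          \<in> relations_ideal"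
        by (simp add: left_diff_distrib flip: monomial_append)
      from relations_ideal_trans[OF this] show ?thesis
        using step Csym by simp
    qed (use step in simp)
  qed
  moreover have "monomial (hword (exponents (hsyms Y)) @ omega (csyms Y)) - monomial (hsyms Y @ omega (csyms Y)) \<in> relations_ideal"
    using hsyms_in_G0[OF assms] G0_subset_H mset_eq_setD[OF mset_hword] mset_hword
    by (intro H_word_permute) blast+
  ultimately have "monomial (hword (exponents (hsyms Y)) @ omega (csyms Y)) - monomial (omega Y) \<in> relations_ideal"
    by (blast intro: relations_ideal_trans)
  then show ?thesis by (simp add: F_word_eq_single lift_single)
qed

lemma lift_minus: "lift (- f) = - lift f"
proof -
  have "lift f + lift (- f) = 0" by (simp add: lift_zero flip: lift_add)
  then show ?thesis by (simp add: eq_neg_iff_add_eq_0 add.commute)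
qed

lemma lift_diff: "lift (f - g) = lift f - lift g"
  using lift_add[of f "- g"] by (simp add: lift_minus)

lemma F_induct [consumes 1, case_names word add scalar]:
  assumes "f \<in> carrier F" and "\<And>Y. Y \<in> Q0 \<Longrightarrow> P (F_word Y)"
    and add: "\<And>f g. P f \<Longrightarrow> P g \<Longrightarrow> P (f + g)" and scalar: "\<And>a f. P f \<Longrightarrow> P (F_scalar a * f)"
  shows "P f"
proof (rule fv.span_induct[of f "F_word ` Q0"])
  show "f \<in> fv.span (F_word ` Q0)" using assms(1) carrier_F_subset_span by blast
  \<comment> \<open>The empty word provides the value at \<open>0\<close>.\<close>
  have "P (F_scalar 0 * F_word [])" by (intro scalar assms(2)) (simp add: Q0_def)
  then have "P 0" by (simp add: F_scalar_simps)
  then show "fv.subspace {f. P f}" using add scalar by (simp add: fv.subspace_def)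
qed (use assms(2) in auto)

lemma lift_mult:
  assumes "f \<in> carrier F" "g \<in> carrier F"
  shows "lift (f * g) - lift f * lift g \<in> relations_ideal"
  using assms(1)
proof (induction f rule: F_induct)
  case (word Y)
  show ?case using assms(2)
  proof (induction g rule: F_induct)
    case (word Z)
    have "Y @ Z \<in> Q0" using word \<open>Y \<in> Q0\<close> by (simp add: Q0_def)
    note YZ = lift_F_word[OF this] and Y = lift_F_word[OF \<open>Y \<in> Q0\<close>] and Z = lift_F_word[OF word]
    have "lift (F_word (Y @ Z)) - monomial (omega (Y @ Z))
        - ((lift (F_word Y) - monomial (omega Y)) * lift (F_word Z)
          + monomial (omega Y) * (lift (F_word Z) - monomial (omega Z))) \<in> relations_ideal"
      by (intro relations_ideal_diff relations_ideal_closed(3,5,6) YZ Y Z)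
    then show ?case
      by (simp add: F_word_simps monomial_append left_diff_distrib right_diff_distrib)
  next
    case (add f g)
    then have "(lift (F_word Y * f) - lift (F_word Y) * lift f) + (lift (F_word Y * g) - lift (F_word Y) * lift g) \<in> relations_ideal"
      by (rule relations_ideal_closed(3))
    then show ?case by (simp add: distrib_left lift_add add_diff_add)
  next
    case (scalar a f)
    then have "scalar a * (lift (F_word Y * f) - lift (F_word Y) * lift f) \<in> relations_ideal"
      by (rule relations_ideal_closed(5))
    then show ?case
      by (simp add: F_scalar_left_commute lift_scalar scalar_left_commute right_diff_distrib)
  qed
next
  case (add f f')
  then have "(lift (f * g) - lift f * lift g) + (lift (f' * g) - lift f' * lift g) \<in> relations_ideal"
    by (rule relations_ideal_closed(3))
  then show ?case by (simp add: distrib_right lift_add add_diff_add)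
next
  case (scalar a f)
  then have "scalar a * (lift (f * g) - lift f * lift g) \<in> relations_ideal"
    by (rule relations_ideal_closed(5))
  then show ?case by (simp add: lift_scalar right_diff_distrib mult.assoc)
qed

lemma lift_commutes_with_H:
  assumes "t \<in> H" "f \<in> carrier F"
  shows "monomial [t] * lift f - lift f * monomial [t] \<in> relations_ideal"
  using assms(2)
proof (induction f rule: F_induct)
  case (word Y)
  let ?d = "lift (F_word Y) - monomial (omega Y)"
  have "monomial [t] * ?d - ?d * monomial [t] + (monomial (t # omega Y) - monomial (omega Y @ [t])) \<in> relations_ideal"
    by (rule relations_ideal_closed(3)[OF relations_ideal_diff[OF
          relations_ideal_closed(5)[OF lift_F_word[OF word]]
          relations_ideal_closed(6)[OF lift_F_word[OF word]]]
        H_commutes_with_weightless[OF assms(1) weightless_omega[OF word]]])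
  moreover have "monomial (t # omega Y) = monomial [t] * monomial (omega Y)"
    by (simp flip: monomial_append)
  ultimately show ?case
    by (simp add: monomial_append left_diff_distrib right_diff_distrib)
next
  case (add f g)
  then have "(monomial [t] * lift f - lift f * monomial [t]) + (monomial [t] * lift g - lift g * monomial [t]) \<in> relations_ideal"
    by (rule relations_ideal_closed(3))
  then show ?case by (simp add: distrib_left distrib_right lift_add add_diff_add)
next
  case (scalar a f)
  then have "scalar a * (monomial [t] * lift f - lift f * monomial [t]) \<in> relations_ideal"
    by (rule relations_ideal_closed(5))
  then show ?case by (simp add: lift_scalar scalar_left_commute right_diff_distrib mult.assoc)
qed

lemma env_word_eq: "env_word X = env_class (monomial X)"
  by (simp add: env_word_def monomial_def)

lemma env_centralizer_simps:
  "monoid.mult (env_centralizer H) = monoid.mult enveloping_algebra" "one (env_centralizer H) = one enveloping_algebra"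
  "ring.zero (env_centralizer H) = ring.zero enveloping_algebra" "add (env_centralizer H) = add enveloping_algebra"
  by (simp_all add: env_centralizer_def)

definition evaluates :: "(('g gen word \<Rightarrow>\<^sub>0 (('g \<Rightarrow>\<^sub>0 nat) \<Rightarrow>\<^sub>0 complex)) \<Rightarrow> ('g word \<Rightarrow>\<^sub>0 complex) set) \<Rightarrow> bool"
  where "evaluates \<phi> \<longleftrightarrow> \<phi> \<in> extensional (carrier F) \<and> \<phi> \<in> ring_hom F (env_centralizer H) \<and>
    (\<forall>a. \<phi> (F_scalar a) = env_scalar a) \<and> (\<forall>x\<in>alphabet. \<phi> (F_gen x) = env_word (gen_word x))"

lemma evaluates_lift: "evaluates (restrict (\<lambda>f. env_class (lift f)) (carrier F))"
  unfolding evaluates_def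
proof (intro conjI allI ballI)
  let ?\<phi> = "restrict (\<lambda>f. env_class (lift f)) (carrier F)"
  have word: "?\<phi> (F_word Y) = env_word (omega Y)" if "Y \<in> Q0" for Y
    using lift_F_word[OF that] F_word_closed[OF that] by (simp add: env_word_eq env_class_eq_iff)
  have one: "?\<phi> 1 = env_class 1"
    using word[of "[]"] by (simp add: F_word_simps Q0_def env_word_eq monomial_Nil)
  show "?\<phi> \<in> extensional (carrier F)" by simp
  show "?\<phi> \<in> ring_hom F (env_centralizer H)"
  proof (rule ring_hom_memI)
    fix f assume f: "f \<in> carrier F"
    then show "?\<phi> f \<in> carrier (env_centralizer H)"
      using lift_commutes_with_H[OF _ f]
      by (simp add: env_centralizer_def env_class_simps env_word_eq env_class_eq_iff)
    fix g assume g: "g \<in> carrier F"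
    show "?\<phi> (f \<otimes>\<^bsub>F\<^esub> g) = ?\<phi> f \<otimes>\<^bsub>env_centralizer H\<^esub> ?\<phi> g"
      using f g lift_mult[OF f g] F_closed(4)[OF f g]
      by (simp add: F_simps env_centralizer_simps env_class_simps env_class_eq_iff)
    show "?\<phi> (f \<oplus>\<^bsub>F\<^esub> g) = ?\<phi> f \<oplus>\<^bsub>env_centralizer H\<^esub> ?\<phi> g"
      using f g F_closed(3)[OF f g]
      by (simp add: F_simps env_centralizer_simps env_class_simps lift_add)
  next
    show "?\<phi> \<one>\<^bsub>F\<^esub> = \<one>\<^bsub>env_centralizer H\<^esub>"
      using one by (simp only: F_simps env_centralizer_simps env_class_simps)
  qed
  fix x assume x: "x \<in> alphabet"
  show "?\<phi> (F_gen x) = env_word (gen_word x)"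
    using word[of "[x]"] x by (simp add: F_word_simps Q0_def)
next
  fix a
  have "lift 1 - 1 \<in> relations_ideal"
    using lift_F_word[of "[]"] by (simp add: F_word_simps Q0_def monomial_Nil)
  then have "scalar a * (lift 1 - 1) \<in> relations_ideal" by (rule relations_ideal_closed(5))
  then show "restrict (\<lambda>f. env_class (lift f)) (carrier F) (F_scalar a) = env_scalar a"
    using lift_scalar[of a 1] F_scalar_closed
    by (simp add: env_scalar_def env_class_eq_iff right_diff_distrib)
qed

lemma evaluates_unique:
  assumes "evaluates \<phi>" "evaluates \<psi>"
  shows "\<phi> = \<psi>"
proof (rule extensionalityI[of _ "carrier F"])
  show "\<phi> \<in> extensional (carrier F)" "\<psi> \<in> extensional (carrier F)"
    using assms by (simp_all add: evaluates_def)
  fix f assume "f \<in> carrier F"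
  note hom = ring_hom_memE[of \<phi> F "env_centralizer H", unfolded F_simps env_centralizer_simps]
    ring_hom_memE[of \<psi> F "env_centralizer H", unfolded F_simps env_centralizer_simps]
  have \<phi>: "\<phi> \<in> ring_hom F (env_centralizer H)" and \<psi>: "\<psi> \<in> ring_hom F (env_centralizer H)"
    using assms by (simp_all add: evaluates_def)
  have "f \<in> carrier F \<and> \<phi> f = \<psi> f"
    using \<open>f \<in> carrier F\<close>
  proof (induction f rule: F_induct)
    case (word Y)
    then show ?case unfolding Q0_def
    proof (induction Y)
      case (Cons a Y)
      then have a: "F_gen a \<in> carrier F" "\<phi> (F_gen a) = \<psi> (F_gen a)"
        using assms F_gen_closed by (auto simp: evaluates_def)
      have "F_word Y \<in> carrier F" "\<phi> (F_word Y) = \<psi> (F_word Y)" using Cons by auto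
      then show ?case using a hom(2)[OF \<phi>] hom(6)[OF \<psi>] by (simp add: F_word_simps F_closed)
    qed (simp add: F_word_simps F_closed hom(4)[OF \<phi>] hom(8)[OF \<psi>])
  next
    case (add f g)
    then show ?case using hom(3)[OF \<phi>] hom(7)[OF \<psi>] by (simp add: F_closed)
  next
    case (scalar a f)
    moreover have "\<phi> (F_scalar a) = \<psi> (F_scalar a)" using assms by (simp add: evaluates_def)
    ultimately show ?case
      using hom(2)[OF \<phi>] hom(6)[OF \<psi>] F_scalar_closed by (simp add: F_closed)
  qed
  then show "\<phi> f = \<psi> f" ..
qed

lemma eval_hom_eq: "f \<in> carrier F \<Longrightarrow> eval_hom f = env_class (lift f)"
proof -
  have "evaluates eval_hom"
    unfolding eval_hom_def evaluates_def[symmetric]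
    using theI'[OF ex1I[of evaluates, OF evaluates_lift evaluates_unique[OF _ evaluates_lift]]] .
  then have "eval_hom = restrict (\<lambda>f. env_class (lift f)) (carrier F)"
    using evaluates_lift evaluates_unique by blast
  then show "f \<in> carrier F \<Longrightarrow> eval_hom f = env_class (lift f)" by simp
qed

lemma mem_K: "f \<in> K \<longleftrightarrow> f \<in> carrier F \<and> lift f \<in> relations_ideal"
proof -
  have "f \<in> K \<longleftrightarrow> f \<in> carrier F \<and> eval_hom f = env_class 0"
    unfolding K_def a_kernel_def kernel_def by (simp add: env_centralizer_simps env_class_simps)
  then show ?thesis by (cases "f \<in> carrier F") (simp_all add: eval_hom_eq env_class_eq_iff)
qed

section \<open>Normal forms\<close>

definition lower_normal_forms :: "nat \<Rightarrow> ('g gen word \<Rightarrow>\<^sub>0 (('g \<Rightarrow>\<^sub>0 nat) \<Rightarrow>\<^sub>0 complex)) set"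
  where "lower_normal_forms n = fv.span (F_word ` {Y. semi_perfect Y \<and> length (omega Y) < n})"

lemma lower_normal_forms_mono: "m \<le> n \<Longrightarrow> lower_normal_forms m \<subseteq> lower_normal_forms n"
  unfolding lower_normal_forms_def by (intro fv.span_mono image_mono) auto

lemma lower_normal_forms_subset: "lower_normal_forms n \<subseteq> semi_perfect_span"
  unfolding lower_normal_forms_def semi_perfect_span_def by (intro fv.span_mono image_mono) auto

lemma word_in_lower_normal_forms:
  "semi_perfect Y \<Longrightarrow> length (omega Y) < n \<Longrightarrow> F_word Y \<in> lower_normal_forms n"
  unfolding lower_normal_forms_def by (rule fv.span_base) blast

lemma length_omega_semi_perfect_word:
  assumes "weightless (mset X)"
  shows "length (omega (semi_perfect_word (mset X))) = length X"
  using mset_eq_length[OF semi_perfect_word(2)[OF assms]] .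

text \<open>
  Swapping two neighbours \<open>x\<close> and \<open>y\<close> in \<open>X\<close> changes the monomial by the word with \<open>[x, y]\<close> in their place. By
  \<open>bracket_expansion\<close> this is a combination of shorter weightless words, to which the induction
  hypothesis applies. So, up to lower normal forms, \<open>X\<close> may be rearranged into \<open>omega Y\<close> for the
  semi-perfect word \<open>Y\<close> with the same letters.
\<close>

lemma monomial_normal_form:
  assumes "weightless (mset X)"
  shows "\<exists>u\<in>lower_normal_forms (length X).
    monomial X - lift (F_word (semi_perfect_word (mset X)) + u) \<in> relations_ideal"
  using assms
proof (induction X rule: measure_induct_rule[of length])
  case (less X)
  \<comment> \<open>The errors allowed while sorting \<open>X\<close>.\<close>
  define D where "D = {p. \<exists>u\<in>lower_normal_forms (length X). p - lift u \<in> relations_ideal}"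
  have D_add: "p + q \<in> D" if pq: "p \<in> D" "q \<in> D" for p q
  proof -
    obtain u v where uv: "u \<in> lower_normal_forms (length X)" "p - lift u \<in> relations_ideal"
      "v \<in> lower_normal_forms (length X)" "q - lift v \<in> relations_ideal" using pq by (auto simp: D_def)
    have "u + v \<in> lower_normal_forms (length X)"
      using uv fv.span_add unfolding lower_normal_forms_def by blast
    moreover have "p + q - lift (u + v) \<in> relations_ideal"
      using relations_ideal_closed(3)[OF uv(2,4)] by (simp add: lift_add add_diff_add)
    ultimately show ?thesis unfolding D_def by blast
  qed
  have D_scalar: "scalar a * p \<in> D" if p: "p \<in> D" for a p
  proof -
    obtain u where u: "u \<in> lower_normal_forms (length X)" "p - lift u \<in> relations_ideal"
      using p by (auto simp: D_def)
    have "F_scalar a * u \<in> lower_normal_forms (length X)"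
      using u fv.span_scale unfolding lower_normal_forms_def by blast
    moreover have "scalar a * p - lift (F_scalar a * u) \<in> relations_ideal"
      using relations_ideal_closed(5)[OF u(2), of "scalar a"] by (simp add: lift_scalar right_diff_distrib)
    ultimately show ?thesis unfolding D_def by blast
  qed
  have D_rel: "p \<in> D" if "p \<in> relations_ideal" for p
    unfolding D_def using that
    by (intro CollectI bexI[of _ 0]) (simp_all add: lift_zero lower_normal_forms_def fv.span_zero)
  have D_zero: "0 \<in> D" by (intro D_rel relations_ideal_closed)
  have D_minus: "- p \<in> D" if "p \<in> D" for p
    using D_scalar[OF that, of "-1"] by (simp add: single_uminus)
  have D_sum: "sum p S \<in> D" if "\<And>i. i \<in> S \<Longrightarrow> p i \<in> D" for p :: "'g \<Rightarrow> _" and S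
    using that by (induction S rule: infinite_finite_induct) (auto intro: D_add D_zero)
  have D_monomial: "monomial Z \<in> D" if Z: "weightless (mset Z)" "length Z < length X" for Z
  proof -
    obtain u where u: "u \<in> lower_normal_forms (length Z)"
      "monomial Z - lift (F_word (semi_perfect_word (mset Z)) + u) \<in> relations_ideal"
      using less.IH[OF Z(2,1)] by blast
    have "F_word (semi_perfect_word (mset Z)) \<in> lower_normal_forms (length X)"
      using Z semi_perfect_word[OF Z(1)] length_omega_semi_perfect_word[OF Z(1)]
      by (intro word_in_lower_normal_forms) simp_all
    moreover have "u \<in> lower_normal_forms (length X)"
      using u(1) lower_normal_forms_mono[of "length Z" "length X"] Z(2) by auto
    ultimately have "F_word (semi_perfect_word (mset Z)) + u \<in> lower_normal_forms (length X)"
      unfolding lower_normal_forms_def by (rule fv.span_add)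
    then show ?thesis using u(2) unfolding D_def by blast
  qed
  let ?Y = "semi_perfect_word (mset X)"
  have Y: "semi_perfect ?Y" "mset (omega ?Y) = mset X" using semi_perfect_word less.prems by auto
  have "monomial X - monomial (omega ?Y) \<in> D"
  proof (rule adjacent_swaps_imp_permutation[where M = "mset X"])
    fix A x y B assume M: "mset (A @ [x, y] @ B) = mset X"
    have G: "x \<in> G" "y \<in> G" "set A \<subseteq> G" "set B \<subseteq> G"
      using mset_eq_setD[OF M] less.prems by (auto simp: weightless_def)
    obtain c where c: "bracket x y = (\<Sum>b\<in>G. scale (c b) b)"
      "\<And>b t. b \<in> G \<Longrightarrow> t \<in> H \<Longrightarrow> c b \<noteq> 0 \<Longrightarrow> wt b t = wt x t + wt y t"
      using bracket_expansion[OF G(1,2)] by blast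
    have "scalar (c b) * monomial (A @ b # B) \<in> D" if b: "b \<in> G" for b
    proof (cases "c b = 0")
      case True
      then show ?thesis by (simp add: D_zero)
    next
      case False
      have "(\<Sum>z\<in>#mset (A @ b # B). wt z t) = (\<Sum>z\<in>#mset (A @ [x, y] @ B). wt z t)" if "t \<in> H" for t
        using c(2)[OF b that False] by (simp add: algebra_simps)
      then have "weightless (mset (A @ b # B))"
        using less.prems G b unfolding M[symmetric] weightless_def by (simp add: add.assoc)
      moreover have "length (A @ b # B) < length X" using mset_eq_length[OF M] by simp
      ultimately show ?thesis by (intro D_scalar D_monomial)
    qed
    then have "(\<Sum>b\<in>G. scalar (c b) * monomial (A @ b # B)) \<in> D" by (rule D_sum)
    moreover have "monomial (A @ bracket x y # B) - (\<Sum>b\<in>G. scalar (c b) * monomial (A @ b # B)) \<in> D"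
      unfolding c(1) by (intro D_rel monomial_linear_combination finite_G)
    moreover have "monomial (A @ x # y # B) - monomial (A @ y # x # B) - monomial (A @ bracket x y # B) \<in> D"
      by (intro D_rel monomial_relations)
    ultimately have "(\<Sum>b\<in>G. scalar (c b) * monomial (A @ b # B))
        + (monomial (A @ bracket x y # B) - (\<Sum>b\<in>G. scalar (c b) * monomial (A @ b # B)))
        + (monomial (A @ x # y # B) - monomial (A @ y # x # B) - monomial (A @ bracket x y # B)) \<in> D"
      by (intro D_add)
    then show "monomial (A @ [x, y] @ B) - monomial (A @ [y, x] @ B) \<in> D" by simp
  qed (simp_all add: D_zero D_add D_minus Y)
  then obtain u where u: "u \<in> lower_normal_forms (length X)"
    "monomial X - monomial (omega ?Y) - lift u \<in> relations_ideal" by (auto simp: D_def)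
  have "?Y \<in> Q0" using Y by (simp add: semi_perfect_def)
  from relations_ideal_diff[OF u(2) lift_F_word[OF this]]
  have "monomial X - lift (F_word ?Y + u) \<in> relations_ideal" by (simp add: lift_add algebra_simps)
  then show ?case using u(1) by blast
qed

text \<open>
  The words \<open>omega Y\<close> of different semi-perfect \<open>Y\<close> have different multisets of letters, so
  \<open>monomials_independent\<close> applies.
\<close>

lemma semi_perfect_span_independent:
  assumes f: "f \<in> semi_perfect_span" "lift f \<in> relations_ideal"
  shows "f = 0"
proof -
  obtain S r where S: "finite S" "S \<subseteq> F_word ` {Y. semi_perfect Y}" "f = (\<Sum>g\<in>S. F_scalar (r g) * g)"
    using f(1) unfolding semi_perfect_span_def fv.span_explicit by blast
  obtain T where T: "T \<subseteq> {Y. semi_perfect Y}" "inj_on F_word T" "S = F_word ` T"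
    using S(2) unfolding subset_image_inj by blast
  have "finite T" using S(1) T finite_imageD by blast
  have Q0: "Y \<in> Q0" if "Y \<in> T" for Y using T(1) that by (auto simp: semi_perfect_def)
  define a where "a Y = r (F_word Y)" for Y
  have f_eq: "f = (\<Sum>Y\<in>T. F_scalar (a Y) * F_word Y)"
    unfolding S(3) T(3) a_def using T(2) by (simp add: sum.reindex)
  have lift_sum: "lift (sum g T) = (\<Sum>Y\<in>T. lift (g Y))" for g
    using \<open>finite T\<close> by (induction T rule: finite_induct) (simp_all add: lift_zero lift_add)
  have "(\<Sum>Y\<in>T. scalar (a Y) * (lift (F_word Y) - monomial (omega Y))) \<in> relations_ideal"
    using lift_F_word[OF Q0] by (intro relations_ideal_sum relations_ideal_closed(5))
  from relations_ideal_diff[OF f(2) this]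
  have rel: "(\<Sum>Y\<in>T. scalar (a Y) * monomial (omega Y)) \<in> relations_ideal"
    by (simp add: f_eq lift_sum lift_scalar right_diff_distrib sum_subtractf)
  obtain l where l: "\<And>g. g \<in> G \<Longrightarrow> lie_functional (l g) \<and> l g [] = 0 \<and> (\<forall>x\<in>G. l g [x] = (if x = g then 1 else 0))"
    using coordinate_lie_functional[OF finite_G G_basis centre_trivial] by metis
  have "a Y = 0" if "Y \<in> T" for Y
  proof (rule monomials_independent[where B = G and l = l and W = omega and T = T])
    show "set (omega Y) \<subseteq> G" if "Y \<in> T" for Y
      using weightless_omega[OF Q0[OF that]] by (simp add: weightless_def)
    show "inj_on (\<lambda>Y. mset (omega Y)) T"
      using T(1) semi_perfect_unique by (auto intro!: inj_onI)
  qed (use l \<open>finite T\<close> rel that in auto)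
  then show ?thesis by (simp add: f_eq F_scalar_simps)
qed

lemma semi_perfect_span_closed: "semi_perfect_span \<subseteq> carrier F"
proof
  fix f assume "f \<in> semi_perfect_span"
  then show "f \<in> carrier F"
    unfolding semi_perfect_span_def
  proof (rule fv.span_induct)
    show "fv.subspace {f. f \<in> carrier F}"
      by (simp add: fv.subspace_def F_closed F_scalar_closed)
  qed (auto simp: semi_perfect_def F_word_closed)
qed

text \<open>
  Existence of the normal form comes from \<open>monomial_normal_form\<close>, uniqueness from
  \<open>semi_perfect_span_independent\<close>. The shape of the normal form, the semi-perfect word of the class plus
  terms of smaller degree, is what drives the reduction below.
\<close>

lemma normal_form_word:
  assumes X: "X \<in> Q0"
  shows "\<exists>u\<in>lower_normal_forms (length (omega X)).
      normal_form (F_word X) = F_word (semi_perfect_word (mset (omega X))) + u"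
    and "normal_form (F_word X) \<in> carrier F"
    and "F_word X - normal_form (F_word X) \<in> K"
proof -
  have w: "weightless (mset (omega X))" using weightless_omega[OF X] .
  obtain u where u: "u \<in> lower_normal_forms (length (omega X))"
    "monomial (omega X) - lift (F_word (semi_perfect_word (mset (omega X))) + u) \<in> relations_ideal"
    using monomial_normal_form[OF w] by blast
  let ?N = "F_word (semi_perfect_word (mset (omega X))) + u"
  have N: "?N \<in> semi_perfect_span"
    using u(1) lower_normal_forms_subset semi_perfect_word(1)[OF w]
    unfolding semi_perfect_span_def by (intro fv.span_add) (auto intro: fv.span_base)
  then have NF: "?N \<in> carrier F" using semi_perfect_span_closed by blast
  have "lift (F_word X) - lift ?N \<in> relations_ideal"
    using relations_ideal_trans[OF lift_F_word[OF X] u(2)] .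
  then have eq: "eval_hom ?N = eval_hom (F_word X)"
    using NF F_word_closed[OF X] by (simp add: eval_hom_eq env_class_eq_iff relations_ideal_commute)
  have "normal_form (F_word X) = ?N"
    unfolding normal_form_def
  proof (rule the_equality)
    fix N' assume N': "N' \<in> semi_perfect_span \<and> eval_hom N' = eval_hom (F_word X)"
    then have "N' \<in> carrier F" using semi_perfect_span_closed by blast
    then have "env_class (lift N') = env_class (lift ?N)"
      using N' eq eval_hom_eq[of N'] eval_hom_eq[OF NF] by simp
    then have "lift (N' - ?N) \<in> relations_ideal" by (simp add: env_class_eq_iff lift_diff)
    moreover have "N' - ?N \<in> semi_perfect_span"
      using N N' unfolding semi_perfect_span_def by (blast intro: fv.span_diff)
    ultimately show "N' = ?N" using semi_perfect_span_independent by force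
  qed (use N eq in simp)
  moreover have "F_word X - ?N \<in> K"
    using \<open>lift (F_word X) - lift ?N \<in> relations_ideal\<close> F_diff_closed[OF F_word_closed[OF X] NF]
    unfolding mem_K lift_diff by simp
  ultimately show "\<exists>u\<in>lower_normal_forms (length (omega X)).
      normal_form (F_word X) = F_word (semi_perfect_word (mset (omega X))) + u"
    "normal_form (F_word X) \<in> carrier F" "F_word X - normal_form (F_word X) \<in> K"
    using u(1) NF by auto
qed

section \<open>Reduction modulo the relations with few factors\<close>

lemma J_subset_alphabet: "J \<subseteq> alphabet"
  by (simp add: alphabet_def)

lemma K'_subset: "K' \<subseteq> K"
  using normal_form_word(3) lists_mono[OF J_subset_alphabet] by (auto simp: K'_def Q0_def)

lemma K'_closed: "K' \<subseteq> carrier F"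
  using K'_subset by (auto simp: mem_K)

definition generated :: "('g gen word \<Rightarrow>\<^sub>0 (('g \<Rightarrow>\<^sub>0 nat) \<Rightarrow>\<^sub>0 complex)) set"
  where "generated = Idl\<^bsub>F\<^esub> K'"

lemmas generated_closed =
  free_algebra_genideal[OF F_ring[unfolded F_def] K'_closed[unfolded F_def], folded F_def generated_def]

lemma generated_subset_K: "generated \<subseteq> K"
  unfolding generated_def F_def
proof (rule free_algebra_genideal_minimal[OF F_ring[unfolded F_def]], unfold F_def[symmetric])
  show "K \<subseteq> carrier F" "0 \<in> K" "K' \<subseteq> K"
    using K'_subset by (auto simp: mem_K F_closed lift_zero relations_ideal_closed)
  fix p q f assume p: "p \<in> K"
  show "p + q \<in> K" if "q \<in> K"
    using p that by (simp add: mem_K F_closed lift_add relations_ideal_closed)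
  show "- p \<in> K"
    using p by (simp add: mem_K F_closed lift_minus relations_ideal_closed)
  assume f: "f \<in> carrier F"
  have p': "p \<in> carrier F" "lift p \<in> relations_ideal" using p by (simp_all add: mem_K)
  have "lift (f * p) - lift f * lift p + lift f * lift p \<in> relations_ideal"
    using lift_mult[OF f p'(1)] p'(2) by (intro relations_ideal_closed(3,5))
  then show "f * p \<in> K" using f p' by (simp add: mem_K F_closed)
  have "lift (p * f) - lift p * lift f + lift p * lift f \<in> relations_ideal"
    using lift_mult[OF p'(1) f] p'(2) by (intro relations_ideal_closed(3,6))
  then show "p * f \<in> K" using f p' by (simp add: mem_K F_closed)
qed

definition lower_words :: "nat \<Rightarrow> ('g gen word \<Rightarrow>\<^sub>0 (('g \<Rightarrow>\<^sub>0 nat) \<Rightarrow>\<^sub>0 complex)) set"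
  where "lower_words n = fv.span (F_word ` {Y \<in> Q0. length (omega Y) < n})"

text \<open>
  The elements that may be discarded while reducing a word \<open>Y\<close> with \<open>length (omega Y) = n\<close>: combinations of
  words of smaller degree, which are reduced by induction, and elements of the ideal.
\<close>

definition negligible :: "nat \<Rightarrow> ('g gen word \<Rightarrow>\<^sub>0 (('g \<Rightarrow>\<^sub>0 nat) \<Rightarrow>\<^sub>0 complex)) set"
  where "negligible n = {u + k | u k. u \<in> lower_words n \<and> k \<in> generated}"

lemma negligible_generated: "k \<in> generated \<Longrightarrow> k \<in> negligible n"
  unfolding negligible_def lower_words_def using fv.span_zero by force

lemma negligible_zero: "0 \<in> negligible n"
  using negligible_generated generated_closed(3) .

lemma negligible_add:
  assumes "p \<in> negligible n" "q \<in> negligible n"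
  shows "p + q \<in> negligible n"
proof -
  obtain u k v l where *: "p = u + k" "q = v + l" "u \<in> lower_words n" "v \<in> lower_words n"
    "k \<in> generated" "l \<in> generated" using assms unfolding negligible_def by blast
  have "p + q = (u + v) + (k + l)" using * by simp
  moreover have "u + v \<in> lower_words n" using * unfolding lower_words_def by (intro fv.span_add)
  ultimately show ?thesis using * generated_closed(4) unfolding negligible_def by blast
qed

lemma generated_scalar: "k \<in> generated \<Longrightarrow> F_scalar a * k \<in> generated"
  by (intro generated_closed(6) F_scalar_closed)

lemma negligible_minus:
  assumes "p \<in> negligible n"
  shows "- p \<in> negligible n"
proof -
  obtain u k where *: "p = u + k" "u \<in> lower_words n" "k \<in> generated"
    using assms unfolding negligible_def by blast
  have "- p = (- u) + (- k)" using * by simp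
  moreover have "- u \<in> lower_words n" using * unfolding lower_words_def by (intro fv.span_neg)
  ultimately show ?thesis using * generated_closed(5) unfolding negligible_def by blast
qed

lemma negligible_trans: "p - q \<in> negligible n \<Longrightarrow> q - r \<in> negligible n \<Longrightarrow> p - r \<in> negligible n"
  using negligible_add[of "p - q" n "q - r"] by simp

lemma negligible_in_context:
  assumes A: "A \<in> Q0" and B: "B \<in> Q0" and p: "p \<in> negligible m"
    and n: "n = length (omega A) + m + length (omega B)"
  shows "F_word A * p * F_word B \<in> negligible n"
proof -
  obtain u k where *: "p = u + k" "u \<in> lower_words m" "k \<in> generated"
    using p unfolding negligible_def by blast
  have "F_word A * u * F_word B \<in> lower_words n"
    using *(2) unfolding lower_words_def
  proof (rule fv.span_induct)
    have "F_word A * (F_scalar c * x) * F_word B = F_scalar c * (F_word A * x * F_word B)" for c x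
      by (simp only: F_scalar_left_commute mult.assoc)
    then show "fv.subspace {u. F_word A * u * F_word B \<in> fv.span (F_word ` {Y \<in> Q0. length (omega Y) < n})}"
      by (simp add: fv.subspace_def fv.span_zero fv.span_add fv.span_scale distrib_left distrib_right)
    fix x assume "x \<in> F_word ` {Y \<in> Q0. length (omega Y) < m}"
    then obtain Y where Y: "x = F_word Y" "Y \<in> Q0" "length (omega Y) < m" by auto
    have "A @ Y @ B \<in> Q0" using A B Y(2) by (simp add: Q0_def)
    moreover have "length (omega (A @ Y @ B)) < n" using Y(3) n by simp
    ultimately have "F_word (A @ Y @ B) \<in> fv.span (F_word ` {Y \<in> Q0. length (omega Y) < n})"
      by (intro fv.span_base) blast
    then show "F_word A * x * F_word B \<in> fv.span (F_word ` {Y \<in> Q0. length (omega Y) < n})"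
      by (simp add: F_word_simps Y(1) mult.assoc)
  qed
  moreover have "F_word A * k * F_word B \<in> generated"
    using *(3) A B by (intro generated_closed(6,7) F_word_closed)
  ultimately show ?thesis
    unfolding *(1) negligible_def by (auto simp: distrib_left distrib_right)
qed

text \<open>
  A relation of \<open>K'\<close> replaces \<open>S\<close> by its normal form, whose terms other than the semi-perfect word have
  smaller degree.
\<close>

lemma short_word_reduces:
  assumes "S \<in> lists J" "length S \<le> d0"
  shows "F_word S - F_word (semi_perfect_word (mset (omega S))) \<in> negligible (length (omega S))"
proof -
  have S: "S \<in> Q0" using assms(1) lists_mono[OF J_subset_alphabet] by (auto simp: Q0_def)
  obtain u where u: "u \<in> lower_normal_forms (length (omega S))"
    "normal_form (F_word S) = F_word (semi_perfect_word (mset (omega S))) + u"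
    using normal_form_word(1)[OF S] by blast
  have "F_word S - normal_form (F_word S) \<in> generated"
    using generated_closed(1) assms unfolding K'_def by blast
  moreover have "u \<in> lower_words (length (omega S))"
    using u(1) fv.span_mono[of "F_word ` {Y. semi_perfect Y \<and> length (omega Y) < length (omega S)}"
        "F_word ` {Y \<in> Q0. length (omega Y) < length (omega S)}"]
    unfolding lower_normal_forms_def lower_words_def by (auto simp: semi_perfect_def)
  ultimately have "u + (F_word S - normal_form (F_word S)) \<in> negligible (length (omega S))"
    unfolding negligible_def by blast
  then show ?thesis by (simp add: u(2))
qed

text \<open>
  Two symbols \<open>c\<^sub>i\<close> and \<open>c\<^sub>j\<close> commute up to negligible terms, because their two products have two factors,
  \<open>2 \<le> d\<^sub>0\<close>, and the same leading semi-perfect word.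
\<close>

lemma permuted_words_congruent:
  assumes X: "X \<in> Q0" "mset X = mset Y"
  shows "F_word X - F_word Y \<in> negligible (length (omega X))"
proof (rule adjacent_swaps_imp_permutation[where M = "mset X"])
  fix A a b B assume M: "mset (A @ [a, b] @ B) = mset X"
  have Q: "A \<in> Q0" "B \<in> Q0" "a \<in> alphabet" "b \<in> alphabet"
    using X(1) mset_eq_setD[OF M] unfolding Q0_def lists_eq_set by auto
  have len_mset: "length (omega X) = length (omega Z)" if "mset X = mset Z" for X Z :: "'g gen list"
  proof -
    have sum: "length (omega V) = (\<Sum>a\<in>#mset V. length (gen_word a))" for V :: "'g gen list"
      by (induction V) simp_all
    show ?thesis unfolding sum that ..
  qed
  have len: "length (omega X) = length (omega A) + length (omega [a, b]) + length (omega B)"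
    using len_mset[OF M] by simp
  have "F_word [a, b] - F_word [b, a] \<in> negligible (length (omega [a, b]))"
  proof (cases "a \<in> J \<and> b \<in> J")
    case True
    then obtain p where "p \<in> I" by (auto simp: J_def)
    \<comment> \<open>Perfect monomials in \<open>I\<close> have degree greater than one.\<close>
    then have "2 \<le> d0" using length_le_d0[of p] by (simp add: I_def)
    then have "F_word [a, b] - F_word (semi_perfect_word (mset (omega [a, b]))) \<in> negligible (length (omega [a, b]))"
      "F_word [b, a] - F_word (semi_perfect_word (mset (omega [b, a]))) \<in> negligible (length (omega [b, a]))"
      using True short_word_reduces[of "[a, b]"] short_word_reduces[of "[b, a]"] by simp_all
    moreover have "mset (omega [b, a]) = mset (omega [a, b])" "length (omega [b, a]) = length (omega [a, b])"
      by simp_all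
    ultimately have "(F_word [a, b] - F_word (semi_perfect_word (mset (omega [a, b]))))
        + - (F_word [b, a] - F_word (semi_perfect_word (mset (omega [a, b])))) \<in> negligible (length (omega [a, b]))"
      by (intro negligible_add negligible_minus) (simp_all add: add.commute)
    then show ?thesis by simp
  next
    case False
    then obtain t where "a = Hsym t \<or> b = Hsym t" using Q by (auto simp: alphabet_def)
    then have "F_word [a, b] = F_word [b, a]"
      using F_gen_Hsym_central[of t "F_gen a"] F_gen_Hsym_central[of t "F_gen b"]
      by (auto simp: F_word_simps)
    then show ?thesis by (simp add: negligible_zero)
  qed
  from negligible_in_context[OF Q(1,2) this len]
  show "F_word (A @ [a, b] @ B) - F_word (A @ [b, a] @ B) \<in> negligible (length (omega X))"
    by (simp only: F_word_simps(3) left_diff_distrib right_diff_distrib mult.assoc)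
qed (use X(2) in \<open>simp_all add: negligible_zero negligible_add negligible_minus\<close>)

text \<open>
  Let \<open>c\<close> be the least letter dividing \<open>omega X\<close>, that is, the first letter of the semi-perfect word of its
  class. The elements of \<open>p\<^sub>c\<close> are covered by a subword \<open>S\<close> of at most \<open>d\<^sub>0\<close> letters (by the letter \<open>c\<close>
  alone, if \<open>c\<close> is in \<open>G\<^sub>0\<close>), which is moved to the front, leaving \<open>R\<close>. Now \<open>S\<close> may be replaced by the
  semi-perfect word of its class. As \<open>c\<close> divides \<open>omega S\<close> and is least even among the letters dividing \<open>omega X\<close>, that word begins with \<open>c\<close>. Thus \<open>X\<close> has become
  \<open>c\<close> times a word of smaller degree, to which the induction hypothesis applies, and prefixing \<open>c\<close> to the
  semi-perfect word found there gives the semi-perfect word of the class of \<open>X\<close>.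
\<close>

lemma word_reduces:
  assumes "X \<in> Q0"
  shows "F_word X - F_word (semi_perfect_word (mset (omega X))) \<in> negligible (length (omega X))"
  using assms
proof (induction X rule: measure_induct_rule[of "\<lambda>X. length (omega X)"])
  case (less X)
  let ?n = "length (omega X)" and ?M = "mset (omega X)"
  have w: "weightless ?M" using weightless_omega less.prems by blast
  show ?case
  proof (cases "X = []")
    case True
    then have "semi_perfect_word ?M = []" using semi_perfect_word_eq[OF semi_perfect_Nil] by simp
    then show ?thesis using True by (simp add: negligible_zero)
  next
    case False
    then have "?M \<noteq> {#}"
      using less.prems weightless_letter(2) by (cases X) (auto simp: Q0_def)
    then obtain c where c: "least_dividing_letter ?M c"
      using exists_least_dividing_letter[OF w] by blast
    then have ca: "c \<in> alphabet" and cM: "mset (gen_word c) \<subseteq># ?M"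
      by (auto simp: least_dividing_letter_def dividing_letters_def)
    obtain N where N: "?M = mset (gen_word c) + N" using cM by (auto simp: mset_subset_eq_exists_conv)
    have sp: "semi_perfect_word ?M = c # semi_perfect_word N" "weightless N"
      using semi_perfect_word_greedy[of c N] w c unfolding N by blast+
    \<comment> \<open>It is enough to bring \<open>c\<close> to the front: the induction hypothesis takes care of the rest.\<close>
    have peel: ?thesis if Z: "Z \<in> Q0" "F_word X - F_word (c # Z) \<in> negligible ?n"
      "mset (gen_word c) + mset (omega Z) = ?M" for Z
    proof -
      have ZN: "mset (omega Z) = N" using Z(3) N by simp
      have len: "?n = length (gen_word c) + length (omega Z)"
        using arg_cong[OF Z(3), of size] by simp
      then have "length (omega Z) < ?n" using weightless_letter(2)[OF ca] by simp
      from less.IH[OF this Z(1)]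
      have "F_word Z - F_word (semi_perfect_word N) \<in> negligible (length (omega Z))" by (simp only: ZN)
      from negligible_in_context[of "[c]" "[]", OF _ _ this, of ?n]
      have "F_word (c # Z) - F_word (c # semi_perfect_word N) \<in> negligible ?n"
        using ca len by (simp add: Q0_def F_word_simps right_diff_distrib)
      from negligible_trans[OF Z(2) this] show ?thesis by (simp add: sp(1))
    qed
    obtain S R where SR: "mset X = mset S + mset R" "length S \<le> size (mset (gen_word c))"
      "mset (gen_word c) \<subseteq># mset (omega S)"
      "\<And>a. a \<in> set S \<Longrightarrow> set (gen_word a) \<inter> set_mset (mset (gen_word c)) \<noteq> {}"
      using covering_letters[OF cM] by blast
    have SR_Q0: "S \<in> Q0" "R \<in> Q0"
      using less.prems arg_cong[OF SR(1), of set_mset] unfolding Q0_def lists_eq_set by auto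
    have omega_mset: "mset (omega X) = (\<Sum>a\<in>#mset X. mset (gen_word a))" for X
      by (induction X) simp_all
    have M_SR: "?M = mset (omega S) + mset (omega R)"
      unfolding omega_mset SR(1) by simp
    have perm: "F_word X - F_word (S @ R) \<in> negligible ?n"
      using permuted_words_congruent[OF less.prems, of "S @ R"] SR(1) by simp
    \<comment> \<open>A letter dividing \<open>omega S\<close> divides \<open>omega X\<close>, so \<open>c\<close> is still the least one.\<close>
    have cS: "least_dividing_letter (mset (omega S)) c"
    proof -
      have "dividing_letters (mset (omega S)) \<subseteq> dividing_letters ?M"
        unfolding dividing_letters_def M_SR using subset_mset.order_trans[OF _ mset_subset_eq_add_left] by blast
      then show ?thesis
        using c ca SR(3) unfolding least_dividing_letter_def dividing_letters_def by blast
    qed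
    have S_reduces: "F_word S - F_word (semi_perfect_word (mset (omega S))) \<in> negligible (length (omega S))"
    proof (cases c)
      case (Csym p)
      then have p: "p \<in> I" using ca by (auto simp: alphabet_def J_def)
      have "a \<in> J" if aS: "a \<in> set S" for a
      proof (rule ccontr)
        assume "a \<notin> J"
        then obtain x where "a = Hsym x" "x \<in> G0"
          using SR_Q0(1) aS unfolding Q0_def alphabet_def lists_eq_set by blast
        then show False using SR(4)[OF aS] root_letters(2)[OF p] Csym by auto
      qed
      moreover have "length S \<le> d0" using SR(2) length_le_d0[OF p] Csym by simp
      ultimately show ?thesis by (intro short_word_reduces) auto
    next
      case (Hsym t)
      then have t: "t \<in> G0" using ca by (auto simp: alphabet_def J_def)
      have "length S \<le> 1" "S \<noteq> []" using SR(2,3) Hsym by auto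
      then obtain a where S: "S = [a]" by (cases S) auto
      have "t \<in> set (gen_word a)" using SR(3) Hsym S by simp
      then have "a = Hsym t"
        using SR_Q0(1) S t by (auto simp: Q0_def alphabet_def J_def dest!: root_letters(2))
      then have "semi_perfect_word (mset (omega S)) = [a]"
        using semi_perfect_word_greedy(1)[of a "{#}"] cS Hsym S weightless_letter(1)[OF ca]
          semi_perfect_word_eq[OF semi_perfect_Nil] by simp
      then show ?thesis using S by (simp add: negligible_zero)
    qed
    obtain N' where N': "mset (omega S) = mset (gen_word c) + N'"
      using SR(3) by (auto simp: mset_subset_eq_exists_conv)
    let ?Z = "semi_perfect_word N'"
    have Z: "semi_perfect_word (mset (omega S)) = c # ?Z" "weightless N'"
      using semi_perfect_word_greedy[of c N'] weightless_omega[OF SR_Q0(1)] cS unfolding N' by blast+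
    have lenS: "?n = length (omega S) + length (omega R)"
      using arg_cong[OF M_SR, of size] by simp
    from negligible_in_context[of "[]" R, OF _ SR_Q0(2) S_reduces, of ?n]
    have "F_word (S @ R) - F_word (c # ?Z @ R) \<in> negligible ?n"
      using lenS by (simp add: Q0_def F_word_simps left_diff_distrib Z(1) mult.assoc)
    from negligible_trans[OF perm this]
    have "F_word X - F_word (c # (?Z @ R)) \<in> negligible ?n" .
    moreover have "?Z @ R \<in> Q0"
      using semi_perfect_word(1)[OF Z(2)] SR_Q0(2) by (simp add: semi_perfect_def Q0_def)
    moreover have "mset (gen_word c) + mset (omega (?Z @ R)) = ?M"
      using semi_perfect_word(2)[OF Z(2)] M_SR N' by simp
    ultimately show ?thesis by (intro peel)
  qed
qed

lemma carrier_F_reduces: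
  assumes "f \<in> carrier F"
  shows "\<exists>u\<in>semi_perfect_span. f - u \<in> generated"
proof -
  define W where "W = {f. \<exists>u\<in>semi_perfect_span. f - u \<in> generated}"
  have "fv.subspace W"
    unfolding fv.subspace_def
  proof (intro conjI ballI allI)
    show "0 \<in> W"
      unfolding W_def semi_perfect_span_def using fv.span_zero generated_closed(3) by force
    fix f g a
    assume f: "f \<in> W"
    then obtain u where u: "u \<in> semi_perfect_span" "f - u \<in> generated" by (auto simp: W_def)
    have "F_scalar a * u \<in> semi_perfect_span"
      using u unfolding semi_perfect_span_def by (intro fv.span_scale)
    moreover have "F_scalar a * f - F_scalar a * u \<in> generated"
      using generated_scalar[OF u(2), of a] by (simp add: right_diff_distrib)
    ultimately show "F_scalar a * f \<in> W" unfolding W_def by blast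
    assume "g \<in> W"
    then obtain v where v: "v \<in> semi_perfect_span" "g - v \<in> generated" by (auto simp: W_def)
    have "u + v \<in> semi_perfect_span"
      using u v unfolding semi_perfect_span_def by (intro fv.span_add)
    moreover have "f + g - (u + v) \<in> generated"
      using generated_closed(4)[OF u(2) v(2)] by (simp add: add_diff_add)
    ultimately show "f + g \<in> W" unfolding W_def by blast
  qed
  note W = this
  have generated_W: "k \<in> W" if "k \<in> generated" for k
    using that unfolding W_def semi_perfect_span_def using fv.span_zero by force
  have "F_word Y \<in> W" if "Y \<in> Q0" for Y
    using that
  proof (induction Y rule: measure_induct_rule[of "\<lambda>Y. length (omega Y)"])
    case (less Y)
    have sp: "semi_perfect (semi_perfect_word (mset (omega Y)))"
      using semi_perfect_word(1) weightless_omega less.prems by blast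
    then have "F_word (semi_perfect_word (mset (omega Y))) \<in> semi_perfect_span"
      unfolding semi_perfect_span_def by (intro fv.span_base) blast
    then have 1: "F_word (semi_perfect_word (mset (omega Y))) \<in> W"
      unfolding W_def using generated_closed(3) by force
    obtain u k where uk: "F_word Y - F_word (semi_perfect_word (mset (omega Y))) = u + k"
      "u \<in> lower_words (length (omega Y))" "k \<in> generated"
      using word_reduces[OF less.prems] unfolding negligible_def by blast
    have "F_word ` {Z \<in> Q0. length (omega Z) < length (omega Y)} \<subseteq> W"
      using less.IH by blast
    then have "u \<in> W" using uk(2) fv.span_minimal[OF _ W] unfolding lower_words_def by blast
    then have "F_word (semi_perfect_word (mset (omega Y))) + (u + k) \<in> W"
      using 1 generated_W[OF uk(3)] fv.subspace_add[OF W] by blast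
    then show ?case by (simp flip: uk(1))
  qed
  then have "fv.span (F_word ` Q0) \<subseteq> W" using W by (intro fv.span_minimal) auto
  then show ?thesis using assms carrier_F_subset_span unfolding W_def by blast
qed

text \<open>
  An element of \<open>K\<close> is congruent modulo the ideal to a combination of semi-perfect words. This
  combination vanishes in \<open>U(\<gg>)\<close>, hence is \<open>0\<close>.
\<close>

lemma K_eq_ideal: "K = Idl\<^bsub>F\<^esub> K'"
proof
  show "K \<subseteq> Idl\<^bsub>F\<^esub> K'"
  proof
    fix f assume f: "f \<in> K"
    then obtain u where u: "u \<in> semi_perfect_span" "f - u \<in> generated"
      using carrier_F_reduces by (auto simp: mem_K)
    have "lift f - lift (f - u) \<in> relations_ideal"
      using f u(2) generated_subset_K by (intro relations_ideal_diff) (auto simp: mem_K)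
    then have "lift u \<in> relations_ideal" by (simp add: lift_diff)
    then have "u = 0" using semi_perfect_span_independent[OF u(1)] by blast
    then show "f \<in> Idl\<^bsub>F\<^esub> K'" using u(2) by (simp add: generated_def)
  qed
  show "Idl\<^bsub>F\<^esub> K' \<subseteq> K" using generated_subset_K by (simp add: generated_def)
qed

end

theorem theorem2p5:
  fixes scale :: "complex \<Rightarrow> 'g::ab_group_add \<Rightarrow> 'g"
    and bracket :: "'g \<Rightarrow> 'g \<Rightarrow> 'g"
    and H :: "'g set"
    and \<pi> :: "('g \<Rightarrow> complex) set"
    and h e :: "('g \<Rightarrow> complex) \<Rightarrow> 'g"
    and ordG :: "('g \<times> 'g) set"
    and ordA :: "('g gen \<times> 'g gen) set"
  assumes "complex_lie_algebra scale bracket"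
    and "complex_lie_algebra.finite_dimensional scale"
    and "complex_lie_algebra.simple scale bracket"
    and "complex_lie_algebra.cartan_subalgebra scale bracket H"
    and "ordered_generators scale bracket H \<pi> h e ordG ordA"
  shows "ordered_root_basis.K scale bracket H \<pi> h e ordG =
    Idl\<^bsub>ordered_root_basis.F scale bracket H \<pi> h e ordG\<^esub>
      (ordered_generators.K' scale bracket H \<pi> h e ordG ordA)"
proof -
  interpret simple_root_basis scale bracket H \<pi> h e ordG ordA
    using assms(2-5) by (intro simple_root_basis.intro simple_root_basis_axioms.intro)
  show ?thesis by (rule K_eq_ideal)
qed

end
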